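(* For the additive Gaussian noise channel with noise variance $N>0$ and power constraint $S>0$, for every real $a$ and every $0<\epsilon<1$, \[ C_p^{G}(a\mid N,S)=G\big(a/\sqrt{V}\big),\qquad C^{G}(\epsilon\mid N,S)=\sqrt{V}\,G^{-1}(\epsilon),\qquad\text{where } V=\frac{\frac{S^2}{N^2}+2\frac{S}{N}}{2(1+\frac SN)^2}. \]
   Context: Input and output alphabets are $\mathbb R$; $W_x$ is the normal distribution with mean $x$ and variance $N$, with density $\frac{1}{\sqrt{2\pi N}}e^{-(y-x)^2/(2N)}$, and $W^{\times n}_x=\prod_iW_{x_i}$ on $\mathbb R^n$. Logarithms are natural. $C^G_{N,S}=\frac12\log(1+\frac SN)$. A code for $W^{\times n}$ is $\Phi=(M,\phi,\{\mathcal D_i\}_{i=1}^M)$ with $\phi:\{1..M\}\to\mathbb R^n$ and pairwise disjoint Borel sets $\mathcal D_i\subset\mathbb R^n$; $|\Phi|=M$, $P_e(\Phi)=\frac1M\sum_i(1-W^{\times n}_{\phi(i)}(\mathcal D_i))$; it satisfies the power constraint if $\sum_{j=1}^n\phi(i)_j^2\le nS$ for every $i$. Over all code sequences satisfying the power constraint: $C_p^G(a|N,S)=\inf\{\limsup_nP_e(\Phi_n):\liminf_n\frac1{\sqrt n}(\log|\Phi_n|-nC^G_{N,S})\ge a\}$, $C^G(\epsilon|N,S)=\sup\{\liminf_n\frac1{\sqrt n}(\log|\Phi_n|-nC^G_{N,S}):\limsup_nP_e(\Phi_n)\le\epsilon\}$. $G$ is the standard normal distribution function. *)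

theory Defs
  imports "HOL-Probability.Probability"
begin

definition W :: "real \<Rightarrow> real \<Rightarrow> real measure" where
  "W N x = density lborel (normal_density x (sqrt N))"

definition Wn :: "real \<Rightarrow> nat \<Rightarrow> (nat \<Rightarrow> real) \<Rightarrow> (nat \<Rightarrow> real) measure" where
  "Wn N n x = PiM {..<n} (\<lambda>j. W N (x j))"

text \<open>A code (M, phi, D): messages 1..M, encoder phi, decoding sets D.\<close>
type_synonym code = "nat \<times> (nat \<Rightarrow> nat \<Rightarrow> real) \<times> (nat \<Rightarrow> (nat \<Rightarrow> real) set)"

definition code_size :: "code \<Rightarrow> nat" where
  "code_size c = fst c"

definition is_code :: "nat \<Rightarrow> code \<Rightarrow> bool" where
  "is_code n c \<longleftrightarrow> (case c of (M, \<phi>, D) \<Rightarrow>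
      M \<ge> 1 \<and>
      (\<forall>i\<in>{1..M}. D i \<in> sets (PiM {..<n} (\<lambda>_. lborel :: real measure))) \<and>
      disjoint_family_on D {1..M})"

definition power_ok :: "real \<Rightarrow> nat \<Rightarrow> code \<Rightarrow> bool" where
  "power_ok S n c \<longleftrightarrow> (case c of (M, \<phi>, D) \<Rightarrow>
      (\<forall>i\<in>{1..M}. (\<Sum>j<n. (\<phi> i j)\<^sup>2) \<le> real n * S))"

definition Pe :: "real \<Rightarrow> nat \<Rightarrow> code \<Rightarrow> real" where
  "Pe N n c = (case c of (M, \<phi>, D) \<Rightarrow>
      (1 / real M) * (\<Sum>i=1..M. 1 - measure (Wn N n (\<phi> i)) (D i)))"

definition CG :: "real \<Rightarrow> real \<Rightarrow> real" where
  "CG N S = 1/2 * ln (1 + S / N)"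

definition admissible :: "real \<Rightarrow> (nat \<Rightarrow> code) \<Rightarrow> bool" where
  "admissible S \<Phi> \<longleftrightarrow> (\<forall>n. is_code n (\<Phi> n) \<and> power_ok S n (\<Phi> n))"

definition second_order_rate :: "real \<Rightarrow> real \<Rightarrow> (nat \<Rightarrow> code) \<Rightarrow> ereal" where
  "second_order_rate N S \<Phi> = liminf (\<lambda>n. ereal ((1 / sqrt (real n)) *
      (ln (real (code_size (\<Phi> n))) - real n * CG N S)))"

definition limsup_Pe :: "real \<Rightarrow> (nat \<Rightarrow> code) \<Rightarrow> ereal" where
  "limsup_Pe N \<Phi> = limsup (\<lambda>n. ereal (Pe N n (\<Phi> n)))"

definition CpG :: "real \<Rightarrow> real \<Rightarrow> real \<Rightarrow> ereal" where
  "CpG a N S = Inf {limsup_Pe N \<Phi> | \<Phi>. admissible S \<Phi> \<and> second_order_rate N S \<Phi> \<ge> ereal a}"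

definition CeG :: "real \<Rightarrow> real \<Rightarrow> real \<Rightarrow> ereal" where
  "CeG \<epsilon> N S = Sup {second_order_rate N S \<Phi> | \<Phi>. admissible S \<Phi> \<and> limsup_Pe N \<Phi> \<le> ereal \<epsilon>}"

definition Gcdf :: "real \<Rightarrow> real" where
  "Gcdf x = measure (density lborel std_normal_density) {..x}"

definition Ginv :: "real \<Rightarrow> real" where
  "Ginv e = (THE x. Gcdf x = e)"

definition dispersion :: "real \<Rightarrow> real \<Rightarrow> real" where
  "dispersion N S = ((S/N)\<^sup>2 + 2 * (S/N)) / (2 * (1 + S/N)\<^sup>2)"

end

(* Compare the channel with the reference output distribution Q = N(0, N+S)^n.  For an input x the
   information density log dW_x/dQ is a quadratic form in the Gaussian noise whose law depends on x
   only through |x|^2; its characteristic function is explicit, so by Levy's theorem it satisfies a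
   central limit theorem along all inputs with |x|^2/n convergent, with variance V at |x|^2 = nS.
   Converse: W_x(D) <= W_x(log dW_x/dQ > t) + e^t Q(D), summed over the codewords; inputs with
   |x|^2/n bounded away from S are only worse because their mean information is smaller by order n.
   Achievability: Feinstein's greedy construction with codewords in the shell
   nS - O(sqrt n) <= |x|^2 <= nS.  This shell has probability bounded below under N(0,S)^n, and
   N(0,S)^n produces the output Q, so conditioning on the shell costs only a constant factor. *)

theory Submission
  imports Defs "HOL-Complex_Analysis.Conformal_Mappings"
begin

section \<open>The standard normal distribution function\<close>

text \<open>Both bounds need the limit law uniformly over all inputs of a given block length, while
  a central limit theorem speaks of one sequence of inputs. A failure of uniformity produces a
  sequence of bad inputs, to which the limit theorem is applied, if necessary along a subsequence;
  this is why it is stated for arbitrary block lengths \<open>m k\<close>. Only the total power of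
  an input is controlled. A single coordinate may carry a fixed share of the variance, so a
  condition of Lindeberg type can fail. The explicit transform avoids this: the part of the form
  that is linear in the noise is exactly Gaussian, however the power is spread. The information
  density is a centred quadratic form minus the deterministic deficit (nS - |x|^2) / (2(N+S)). The
  deficit dictates the shell: a width that is a small multiple of sqrt n still has probability
  bounded below, and it shifts the second-order rate by an amount that can be made as small as
  desired.\<close>

lemma Gcdf_eq_cdf: "Gcdf = cdf std_normal_distribution"
  by (simp add: fun_eq_iff Gcdf_def cdf_def)

lemma isCont_Gcdf: "isCont Gcdf c"
proof -
  interpret S: real_distribution std_normal_distribution by (rule real_dist_normal_dist)
  have "emeasure std_normal_distribution {c} = 0"
    by (subst emeasure_density) (auto intro!: nn_integral_0_iff_AE[THEN iffD2] AE_I[of _ _ "{c}"])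
  then show ?thesis by (simp add: S.isCont_cdf measure_def Gcdf_eq_cdf)
qed

lemma Gcdf_strict_mono: "strict_mono Gcdf"
proof (rule strict_monoI)
  fix x y :: real assume xy: "x < y"
  interpret S: real_distribution std_normal_distribution by (rule real_dist_normal_dist)
  have "emeasure std_normal_distribution {x<..y} \<noteq> 0"
  proof
    assume "emeasure std_normal_distribution {x<..y} = 0"
    then have "AE z in lborel. ennreal (std_normal_density z) * indicator {x<..y} z = 0"
      by (subst (asm) emeasure_density) (auto simp: nn_integral_0_iff_AE)
    then have "AE z in lborel. z \<notin> {x<..y}"
    proof eventually_elim
      case (elim z)
      then show ?case using normal_density_pos[of 1 0 z] by (auto simp: ennreal_eq_0_iff)
    qed
    then have "{x<..y} \<in> null_sets lborel" by (subst AE_iff_null_sets) simp_all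
    then show False using xy by auto
  qed
  then have "measure std_normal_distribution {x<..y} > 0"
    by (simp add: S.emeasure_eq_measure zero_less_measure_iff)
  then show "Gcdf x < Gcdf y"
    using S.cdf_diff_eq[OF xy] by (simp add: Gcdf_eq_cdf)
qed

lemma Gcdf_mono: "x \<le> y \<Longrightarrow> Gcdf x \<le> Gcdf y"
  using Gcdf_strict_mono by (simp add: strict_mono_less_eq)

lemma Gcdf_at_top: "(Gcdf \<longlongrightarrow> 1) at_top" and Gcdf_at_bot: "(Gcdf \<longlongrightarrow> 0) at_bot"
  and Gcdf_le_1: "Gcdf x \<le> 1"
proof -
  interpret S: real_distribution std_normal_distribution by (rule real_dist_normal_dist)
  show "(Gcdf \<longlongrightarrow> 1) at_top" "(Gcdf \<longlongrightarrow> 0) at_bot" "Gcdf x \<le> 1"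
    unfolding Gcdf_eq_cdf
    by (rule S.cdf_lim_at_top_prob S.cdf_lim_at_bot S.cdf_bounded_prob)+
qed

text \<open>\<open>Ginv\<close> is a definite description, so it carries information only once
  existence (intermediate value between the limits 0 and 1) and uniqueness (strict monotonicity) are
  known.\<close>

lemma Gcdf_Ginv:
  assumes "0 < e" "e < 1"
  shows "Gcdf (Ginv e) = e"
proof -
  have "eventually (\<lambda>x. Gcdf x > e) at_top" "eventually (\<lambda>x. Gcdf x < e) at_bot"
    using order_tendstoD[OF Gcdf_at_top] order_tendstoD[OF Gcdf_at_bot] assms by auto
  then obtain u l where "Gcdf u > e" "Gcdf l < e"
    by (auto simp: eventually_at_top_linorder eventually_at_bot_linorder)
  moreover from this have "l \<le> u" using Gcdf_mono[of u l] by linarith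
  ultimately obtain x where x: "Gcdf x = e"
    using IVT[of Gcdf l e u] isCont_Gcdf by auto
  have "inj Gcdf" using Gcdf_strict_mono by (rule strict_mono_imp_inj_on)
  then show ?thesis unfolding Ginv_def using x by (intro theI[of "\<lambda>x. Gcdf x = e"]) (auto dest: injD)
qed

section \<open>Exponential moments of Gaussian quadratic forms\<close>

text \<open>Completing the square turns the weighted density into a multiple of the normal density
  with mean \<open>w / k\<close> and variance \<open>1 / k\<close>, where
  \<open>k = 1 - 2 * s\<close>; the bound on \<open>s\<close> says exactly
  \<open>k > 0\<close>.\<close>

lemma gaussian_exp_quadratic_real:
  fixes s w :: real
  assumes s: "s < 1/2"
  shows "has_bochner_integral std_normal_distribution (\<lambda>u. exp (s * u\<^sup>2 + w * u))
           (exp (w\<^sup>2 / (2 * (1 - 2 * s))) / sqrt (1 - 2 * s))"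
proof -
  define k where "k = 1 - 2 * s"
  have k: "k > 0" "s = (1 - k) / 2" using s by (auto simp: k_def)
  have eq: "std_normal_density u * exp (s * u\<^sup>2 + w * u) =
        exp (w\<^sup>2 / (2 * k)) / sqrt k * normal_density (w / k) (1 / sqrt k) u" for u
  proof -
    have "- u\<^sup>2 / 2 + (s * u\<^sup>2 + w * u) = w\<^sup>2 / (2 * k) - (u - w / k)\<^sup>2 / (2 * (1 / k))"
      using k(1) unfolding k(2) by (simp add: field_simps power2_eq_square)
    then have e: "exp (- u\<^sup>2 / 2) * exp (s * u\<^sup>2 + w * u) =
        exp (w\<^sup>2 / (2 * k)) * exp (- (u - w / k)\<^sup>2 / (2 * (1 / k)))"
      by (metis exp_add uminus_add_conv_diff add.commute minus_divide_left)
    have q: "sqrt (2 * pi * (1 / k)) = sqrt (2 * pi) / sqrt k"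
      by (simp add: real_sqrt_divide)
    have r: "(1 / sqrt k)\<^sup>2 = 1 / k" using k by (simp add: power_divide)
    have "std_normal_density u * exp (s * u\<^sup>2 + w * u) =
        1 / sqrt (2 * pi) * (exp (- u\<^sup>2 / 2) * exp (s * u\<^sup>2 + w * u))"
      by (simp add: normal_density_def)
    also have "\<dots> = exp (w\<^sup>2 / (2 * k)) / sqrt k * normal_density (w / k) (1 / sqrt k) u"
      unfolding e normal_density_def r q using k(1) by simp
    finally show ?thesis .
  qed
  have "has_bochner_integral lborel (normal_density (w / k) (1 / sqrt k)) 1"
    using k by (simp add: has_bochner_integral_iff)
  then have "has_bochner_integral lborel
      (\<lambda>u. std_normal_density u * exp (s * u\<^sup>2 + w * u)) (exp (w\<^sup>2 / (2 * k)) / sqrt k)"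
    unfolding eq using has_bochner_integral_mult_right[of "exp (w\<^sup>2 / (2 * k)) / sqrt k"] by fastforce
  then show ?thesis
    unfolding k_def by (intro has_bochner_integral_density) auto
qed

text \<open>The absolute value of \<open>B * u\<close> is one of \<open>B * u\<close> and
  \<open>- B * u\<close>, so the integrand lies below the sum of two exponentials of quadratics,
  both integrable by the previous formula.\<close>

lemma gaussian_exp_abs_integrable:
  fixes r A B :: real
  assumes "0 \<le> r" "r * \<bar>A\<bar> < 1/2"
  shows "integrable std_normal_distribution (\<lambda>u. exp (r * \<bar>A * u\<^sup>2 + B * u\<bar>))"
proof (rule Bochner_Integration.integrable_bound)
  let ?g = "\<lambda>u. exp (r * \<bar>A\<bar> * u\<^sup>2 + (r * B) * u) + exp (r * \<bar>A\<bar> * u\<^sup>2 + (- (r * B)) * u)"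
  show "integrable std_normal_distribution ?g"
    using assms gaussian_exp_quadratic_real[of "r * \<bar>A\<bar>"]
    by (intro Bochner_Integration.integrable_add) (simp_all only: has_bochner_integral_iff)
  show "AE u in std_normal_distribution. norm (exp (r * \<bar>A * u\<^sup>2 + B * u\<bar>)) \<le> norm (?g u)"
  proof (rule AE_I2)
    fix u :: real
    have "r * \<bar>A * u\<^sup>2 + B * u\<bar> \<le> r * (\<bar>A\<bar> * u\<^sup>2 + \<bar>B * u\<bar>)"
      using assms(1) by (intro mult_left_mono) (auto intro!: order_trans[OF abs_triangle_ineq] simp: abs_mult)
    also have "\<dots> \<le> max (r * \<bar>A\<bar> * u\<^sup>2 + (r * B) * u) (r * \<bar>A\<bar> * u\<^sup>2 + (- (r * B)) * u)"
      by (auto simp: abs_if algebra_simps max_def)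
    finally have "exp (r * \<bar>A * u\<^sup>2 + B * u\<bar>) \<le> exp \<dots>" by simp
    also have "\<dots> \<le> ?g u" by (auto simp: max_def)
    finally show "norm (exp (r * \<bar>A * u\<^sup>2 + B * u\<bar>)) \<le> norm (?g u)" by simp
  qed
qed auto

text \<open>Both sides are holomorphic in \<open>z\<close> (the left one by its moment series) and agree for real \<open>z\<close>.\<close>

lemma gaussian_exp_quadratic_complex:
  fixes A B :: real and z :: complex
  assumes z: "norm z * \<bar>A\<bar> < 1/2"
  shows "(\<integral>u. exp (z * of_real (A * u\<^sup>2 + B * u)) \<partial>std_normal_distribution) =
          exp (- (1/2) * Ln (1 - 2 * z * A) + (z * B)\<^sup>2 / (2 * (1 - 2 * z * A)))"
proof -
  define Q where "Q u = A * u\<^sup>2 + B * u" for u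
  have [measurable]: "Q \<in> borel_measurable borel" unfolding Q_def by measurable
  \<comment> \<open>Room beyond \<open>norm z\<close>: the power series and the identity theorem
    live on the open disc of radius \<open>r\<close>, which has to contain \<open>z\<close> and
    still meet the integrability bound. For \<open>A = 0\<close> every radius meets it.\<close>
  obtain r where r: "norm z < r" "r * \<bar>A\<bar> < 1/2"
  proof (cases "A = 0")
    case True then show ?thesis using that[of "norm z + 1"] by simp
  next
    case False
    then have "norm z < 1 / (2 * \<bar>A\<bar>)" using z by (simp add: field_simps)
    then obtain r where "norm z < r" "r < 1 / (2 * \<bar>A\<bar>)" using dense by blast
    then show ?thesis using False by (intro that[of r]) (auto simp: field_simps)
  qed
  have r0: "0 < r" using r(1) norm_ge_zero[of z] by linarith
  define c where "c n = (\<integral>u. of_real (Q u ^ n / fact n) \<partial>std_normal_distribution :: complex)" for n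
  let ?F = "\<lambda>z::complex. \<integral>u. exp (z * of_real (Q u)) \<partial>std_normal_distribution"
  let ?H = "\<lambda>z::complex. exp (- (1/2) * Ln (1 - 2 * z * A) + (z * B)\<^sup>2 / (2 * (1 - 2 * z * A)))"
  \<comment> \<open>Partial sums of the exponential series stay below
    \<open>exp (r * \<bar>Q u\<bar>)\<close>, which is integrable. This single dominating function
    gives all moments and permits exchanging sum and integral.\<close>
  have intabs: "integrable std_normal_distribution (\<lambda>u. \<bar>Q u\<bar> ^ n / fact n)"
    and summ: "summable (\<lambda>n. \<integral>u. \<bar>\<zeta>\<bar> ^ n * (\<bar>Q u\<bar> ^ n / fact n) \<partial>std_normal_distribution)"
    if z': "\<bar>\<zeta>\<bar> < r" for \<zeta> :: real and n
  proof -
    have I: "integrable std_normal_distribution (\<lambda>u. exp (r * \<bar>Q u\<bar>))"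
      unfolding Q_def using r r0 by (intro gaussian_exp_abs_integrable) auto
    have part: "(\<Sum>n<k. \<rho> ^ n * (\<bar>Q u\<bar> ^ n / fact n)) \<le> exp (\<rho> * \<bar>Q u\<bar>)" if "0 \<le> \<rho>" for u k and \<rho> :: real
    proof -
      have S: "(\<lambda>n. (\<rho> * \<bar>Q u\<bar>) ^ n /\<^sub>R fact n) sums exp (\<rho> * \<bar>Q u\<bar>)" by (rule exp_converges)
      have "(\<Sum>n<k. (\<rho> * \<bar>Q u\<bar>) ^ n /\<^sub>R fact n) \<le> exp (\<rho> * \<bar>Q u\<bar>)"
        using that by (subst sums_unique[OF S], intro sum_le_suminf sums_summable[OF S]) auto
      then show ?thesis by (simp add: power_mult_distrib field_simps)
    qed
    have trm: "\<rho> ^ n * (\<bar>Q u\<bar> ^ n / fact n) \<le> exp (\<rho> * \<bar>Q u\<bar>)" if "0 \<le> \<rho>" for u n and \<rho> :: real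
    proof -
      have "\<rho> ^ n * (\<bar>Q u\<bar> ^ n / fact n) \<le> (\<Sum>n<Suc n. \<rho> ^ n * (\<bar>Q u\<bar> ^ n / fact n))"
        using that by (auto intro!: sum_nonneg)
      then show ?thesis using part[OF that, of u "Suc n"] by linarith
    qed
    have int1: "integrable std_normal_distribution (\<lambda>u. r ^ n * (\<bar>Q u\<bar> ^ n / fact n))" for n
    proof (rule Bochner_Integration.integrable_bound[OF I])
      show "AE u in std_normal_distribution. norm (r ^ n * (\<bar>Q u\<bar> ^ n / fact n)) \<le> norm (exp (r * \<bar>Q u\<bar>))"
        using trm[of r n] r0 by (intro AE_I2) simp
    qed measurable
    have int2: "integrable std_normal_distribution (\<lambda>u. \<bar>Q u\<bar> ^ n / fact n)" for n
    proof -
      have "(\<lambda>u. 1 / r ^ n * (r ^ n * (\<bar>Q u\<bar> ^ n / fact n))) = (\<lambda>u. \<bar>Q u\<bar> ^ n / fact n)"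
        using r0 by auto
      then show ?thesis
        using integrable_mult_right[OF int1, of "1 / r ^ n" n] by (simp only:)
    qed
    then show "integrable std_normal_distribution (\<lambda>u. \<bar>Q u\<bar> ^ n / fact n)" .
    show "summable (\<lambda>n. \<integral>u. \<bar>\<zeta>\<bar> ^ n * (\<bar>Q u\<bar> ^ n / fact n) \<partial>std_normal_distribution)"
    proof (rule summableI_nonneg_bounded)
      fix k
      have "(\<Sum>n<k. \<integral>u. \<bar>\<zeta>\<bar> ^ n * (\<bar>Q u\<bar> ^ n / fact n) \<partial>std_normal_distribution)
         = (\<integral>u. (\<Sum>n<k. \<bar>\<zeta>\<bar> ^ n * (\<bar>Q u\<bar> ^ n / fact n)) \<partial>std_normal_distribution)"
        by (rule Bochner_Integration.integral_sum[symmetric]) (intro integrable_mult_right int2)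
      also have "\<dots> \<le> (\<integral>u. exp (r * \<bar>Q u\<bar>) \<partial>std_normal_distribution)"
      proof (rule integral_mono)
        show "integrable std_normal_distribution (\<lambda>u. \<Sum>n<k. \<bar>\<zeta>\<bar> ^ n * (\<bar>Q u\<bar> ^ n / fact n))"
          by (intro Bochner_Integration.integrable_sum integrable_mult_right int2)
        fix u
        have "\<bar>\<zeta>\<bar> * \<bar>Q u\<bar> \<le> r * \<bar>Q u\<bar>" using z' by (intro mult_right_mono) auto
        then have "exp (\<bar>\<zeta>\<bar> * \<bar>Q u\<bar>) \<le> exp (r * \<bar>Q u\<bar>)" by simp
        then show "(\<Sum>n<k. \<bar>\<zeta>\<bar> ^ n * (\<bar>Q u\<bar> ^ n / fact n)) \<le> exp (r * \<bar>Q u\<bar>)"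
          by (rule order_trans[OF part[of "\<bar>\<zeta>\<bar>" u k, OF abs_ge_zero]])
      qed (rule I)
      finally show "(\<Sum>n<k. \<integral>u. \<bar>\<zeta>\<bar> ^ n * (\<bar>Q u\<bar> ^ n / fact n) \<partial>std_normal_distribution)
          \<le> (\<integral>u. exp (r * \<bar>Q u\<bar>) \<partial>std_normal_distribution)" .
    qed (simp add: integral_nonneg)
  qed
  have Fsums: "(\<lambda>n. c n * \<zeta> ^ n) sums ?F \<zeta>" if "norm \<zeta> < r" for \<zeta>
  proof -
    let ?f = "\<lambda>n u. \<zeta> ^ n * of_real (Q u ^ n / fact n)"
    have "(\<lambda>n. integral\<^sup>L std_normal_distribution (?f n)) sums (\<integral>u. (\<Sum>n. ?f n u) \<partial>std_normal_distribution)"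
    proof (rule sums_integral)
      fix n
      have "integrable std_normal_distribution (\<lambda>u. of_real (Q u ^ n / fact n) :: complex)"
        using intabs[of 0 n] r0
        by (intro Bochner_Integration.integrable_bound[OF intabs[of 0 n]])
          (auto simp: norm_divide norm_power norm_mult)
      then show "integrable std_normal_distribution (?f n)"
        by (rule integrable_mult_right)
    next
      have "summable (\<lambda>n. (norm \<zeta> * \<bar>Q u\<bar>) ^ n /\<^sub>R fact n)" for u
        using exp_converges sums_iff by blast
      then show "AE u in std_normal_distribution. summable (\<lambda>n. norm (?f n u))"
        by (intro AE_I2) (simp add: norm_mult norm_power norm_divide power_mult_distrib field_simps)
    next
      show "summable (\<lambda>n. \<integral>u. norm (?f n u) \<partial>std_normal_distribution)"
        using summ[of "norm \<zeta>"] that by (simp add: norm_mult norm_power norm_divide)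
    qed
    moreover have "(\<Sum>n. ?f n u) = exp (\<zeta> * of_real (Q u))" for u
    proof -
      have "?f n u = (\<zeta> * of_real (Q u)) ^ n /\<^sub>R fact n" for n
        by (simp add: power_mult_distrib field_simps scaleR_conv_of_real)
      then show ?thesis by (simp add: exp_def)
    qed
    moreover have "integral\<^sup>L std_normal_distribution (?f n) = c n * \<zeta> ^ n" for n
      unfolding c_def by simp
    ultimately show ?thesis by simp
  qed
  have Fhol: "?F holomorphic_on ball 0 r"
    by (rule power_series_holomorphic[where a=c]) (use Fsums in auto)
  \<comment> \<open>In the right half plane \<open>1 - 2 * \<zeta> * A\<close> avoids the branch cut
    of \<open>Ln\<close>, so the principal branch gives a holomorphic inverse square root on the
    whole disc.\<close>
  have re: "Re (1 - 2 * \<zeta> * A) > 0" if "norm \<zeta> < r" for \<zeta> :: complex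
  proof -
    have "\<bar>Re \<zeta> * A\<bar> \<le> norm \<zeta> * \<bar>A\<bar>"
      by (simp add: abs_mult abs_Re_le_cmod mult_right_mono)
    also have "\<dots> \<le> r * \<bar>A\<bar>" using that by (intro mult_right_mono) auto
    finally have "\<bar>Re \<zeta> * A\<bar> < 1/2" using r by linarith
    then have "Re \<zeta> * A < 1/2" by linarith
    then show ?thesis by simp
  qed
  have Hhol: "?H holomorphic_on ball 0 r"
  proof (intro holomorphic_intros)
    fix \<zeta> :: complex assume "\<zeta> \<in> ball 0 r"
    then have *: "Re (1 - 2 * \<zeta> * A) > 0" using re by simp
    then show "1 - 2 * \<zeta> * A \<notin> \<real>\<^sub>\<le>\<^sub>0" using complex_nonpos_Reals_iff by force
    show "2 * (1 - 2 * \<zeta> * A) \<noteq> 0"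
    proof
      assume "2 * (1 - 2 * \<zeta> * A) = 0"
      then have "1 - 2 * \<zeta> * A = 0" by (metis mult_eq_0_iff zero_neq_numeral)
      then show False using * by (simp only: zero_complex.sel less_irrefl)
    qed
  qed
  have real: "?F (of_real x) = ?H (of_real x)" if "\<bar>x\<bar> < r" for x :: real
  proof -
    have p: "1 - 2 * x * A > 0" using re[of "of_real x"] that by simp
    have "(\<integral>u. exp (x * Q u) \<partial>std_normal_distribution) =
       exp ((x * B)\<^sup>2 / (2 * (1 - 2 * (x * A)))) / sqrt (1 - 2 * (x * A))"
      using gaussian_exp_quadratic_real[of "x * A" "x * B"] p
      by (simp add: has_bochner_integral_iff Q_def algebra_simps)
    moreover have "?F (of_real x) = of_real (\<integral>u. exp (x * Q u) \<partial>std_normal_distribution)"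
      by (simp add: exp_of_real flip: of_real_mult integral_of_real)
    moreover have "?H (of_real x) = of_real (exp (- (1/2) * ln (1 - 2 * x * A) + (x * B)\<^sup>2 / (2 * (1 - 2 * x * A))))"
    proof -
      have "Ln (1 - 2 * of_real x * of_real A) = of_real (ln (1 - 2 * x * A))"
        using Ln_of_real[OF p] by simp
      then show ?thesis by (simp flip: exp_of_real)
    qed
    moreover have E: "exp (- (1/2) * ln (1 - 2 * x * A)) = 1 / sqrt (1 - 2 * x * A)"
      using p by (simp add: exp_minus ln_sqrt[symmetric] field_simps)
    moreover have "exp (- (1/2) * ln (1 - 2 * x * A) + (x * B)\<^sup>2 / (2 * (1 - 2 * x * A))) =
        exp ((x * B)\<^sup>2 / (2 * (1 - 2 * (x * A)))) / sqrt (1 - 2 * (x * A))"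
      unfolding exp_add E by (simp add: mult.assoc)
    ultimately show ?thesis by (simp only:)
  qed
  have "?F z - ?H z = 0"
  proof (rule analytic_continuation[where f="\<lambda>z. ?F z - ?H z" and w=z and S="ball 0 r" and U="of_real ` {-r<..<r}" and \<xi>=0])
    show "(\<lambda>z. ?F z - ?H z) holomorphic_on ball 0 r" using Fhol Hhol by (rule holomorphic_on_diff)
    show "(0::complex) islimpt of_real ` {- r<..<r}"
      unfolding islimpt_approachable
    proof (intro allI impI)
      fix e :: real assume "e > 0"
      then have "min (r/2) (e/2) \<in> {-r<..<r} - {0}" "min (r/2) (e/2) < e" "0 < min (r/2) (e/2)"
        using r0 by (simp_all add: min_def)
      then obtain d where "d \<in> {-r<..<r}" "0 < d" "d < e" by blast
      then have "complex_of_real d \<in> complex_of_real ` {-r<..<r}" "complex_of_real d \<noteq> 0"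
        "dist (complex_of_real d) 0 < e"
        by auto
      then show "\<exists>x'\<in>complex_of_real ` {-r<..<r}. x' \<noteq> 0 \<and> dist x' 0 < e" by blast
    qed
    show "z \<in> ball 0 r" using r by simp
    show "?F \<zeta> - ?H \<zeta> = 0" if "\<zeta> \<in> of_real ` {- r<..<r}" for \<zeta>
    proof -
      from that obtain x where x: "\<zeta> = of_real x" "\<bar>x\<bar> < r" by (auto simp: abs_less_iff)
      show ?thesis unfolding x(1) using real[OF x(2)] by (simp only: diff_self)
    qed
    show "complex_of_real ` {- r<..<r} \<subseteq> ball 0 r"
      by (auto simp: abs_less_iff)
  qed (use r0 in simp_all)
  then show ?thesis by (simp add: Q_def)
qed

section \<open>The Gaussian channel, its n-fold product, and the transforms of centred quadratic
  forms of the noise\<close>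

lemma W_sets[measurable_cong, simp]: "sets (W N x) = sets borel" and W_space[simp]: "space (W N x) = UNIV"
  by (simp_all add: W_def)

lemma prob_space_W: "N > 0 \<Longrightarrow> prob_space (W N x)"
  unfolding W_def by (rule prob_space_normal_density) simp

lemma W_eq_distr:
  assumes "N > 0"
  shows "W N x = distr std_normal_distribution borel (\<lambda>u. x + sqrt N * u)"
proof -
  interpret prob_space std_normal_distribution using prob_space_normal_density[of 1 0] by simp
  have "distributed std_normal_distribution lborel (\<lambda>u. u) std_normal_density"
    by (simp add: distributed_def distr_id2 cong: distr_cong)
  from normal_density_affine[OF this, of "sqrt N" x] show ?thesis
    using assms by (simp add: W_def distributed_def distr_cong[of _ _ lborel borel])
qed

lemma Wn_sets[measurable_cong, simp]: "sets (Wn N n x) = sets (PiM {..<n} (\<lambda>_. borel))"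
  and Wn_space[simp]: "space (Wn N n x) = space (PiM {..<n} (\<lambda>_. borel))"
  by (auto simp: Wn_def space_PiM intro!: sets_PiM_cong)

lemma prob_space_Wn: "N > 0 \<Longrightarrow> prob_space (Wn N n x)"
  unfolding Wn_def by (intro prob_space_PiM prob_space_W)

text \<open>Taylor expansion at 0 with the linear term removed; \<open>f 1\<close>,
  \<open>f 2\<close>, \<open>f 3\<close> are the derivatives of \<open>f 0\<close>. On the disc
  \<open>norm (1 - 2 * z) \<ge> 1/2\<close>, so the third derivative is at most 64, and the
  remainder bound with denominator \<open>fact 2\<close> gives 32.\<close>

lemma minus_half_Ln_approx:
  fixes w :: complex
  assumes "norm w < 1/4"
  shows "norm (- (1/2) * Ln (1 - 2 * w) - w - w\<^sup>2) \<le> 32 * norm w ^ 3"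
proof -
  define f where "f n z = (if n = 0 then - (1/2) * Ln (1 - 2 * z) - z
       else if n = 1 then 1 / (1 - 2 * z) - 1
       else if n = 2 then 2 / (1 - 2 * z)\<^sup>2 else 8 / (1 - 2 * z)^3)" for n :: nat and z :: complex
  have norm_ge: "norm (1 - 2 * z) \<ge> 1/2" and Re_pos: "Re (1 - 2 * z) > 0" if "z \<in> ball 0 (1/4)" for z :: complex
  proof -
    have z: "norm z < 1/4" using that by simp
    have "norm (1::complex) \<le> norm (1 - 2 * z) + norm (2 * z)" using norm_triangle_ineq[of "1 - 2 * z" "2 * z"] by simp
    then show "norm (1 - 2 * z) \<ge> 1/2" using z by (simp add: norm_mult)
    show "Re (1 - 2 * z) > 0" using z abs_Re_le_cmod[of z] by simp
  qed
  have "norm (f 0 w - (\<Sum>i\<le>2. f i 0 * (w - 0) ^ i / fact i)) \<le> 64 * norm (w - 0) ^ Suc 2 / fact 2"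
  proof (rule complex_Taylor[where S="ball 0 (1/4)"])
    fix i :: nat and z :: complex assume z: "z \<in> ball 0 (1/4)" and i: "i \<le> 2"
    have nz: "1 - 2 * z \<notin> \<real>\<^sub>\<le>\<^sub>0" "1 - 2 * z \<noteq> 0"
      using Re_pos[OF z] complex_nonpos_Reals_iff by force+
    consider "i = 0" | "i = 1" | "i = 2" using i by linarith
    then show "(f i has_field_derivative f (Suc i) z) (at z within ball 0 (1/4))"
    proof cases
      case 1 then show ?thesis unfolding f_def using nz
        by (auto intro!: derivative_eq_intros simp: field_simps)
    next
      case 2 then show ?thesis unfolding f_def using nz
        by (auto intro!: derivative_eq_intros simp: power2_eq_square)
    next
      case 3
      define k where "k = 1 - 2 * z"
      have "((\<lambda>z. 2 / (1 - 2 * z)\<^sup>2) has_field_derivative (8 * k) / (k\<^sup>2 * k\<^sup>2)) (at z within ball 0 (1/4))"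
        using nz by (auto intro!: derivative_eq_intros simp: k_def)
      moreover have "(8 * k) / (k\<^sup>2 * k\<^sup>2) = 8 / k ^ 3"
        using nz by (simp add: k_def[symmetric] power2_eq_square power3_eq_cube)
      ultimately show ?thesis using 3 by (simp add: f_def[abs_def] k_def)
    qed
  next
    fix z :: complex assume "z \<in> ball 0 (1/4)"
    from norm_ge[OF this] have "(1/2)^3 \<le> norm (1 - 2 * z) ^ 3" by (intro power_mono) auto
    then have "norm (1 - 2 * z) ^ 3 > 0 \<and> 8 \<le> 64 * norm (1 - 2 * z) ^ 3"
      by (simp add: power3_eq_cube)
    then show "norm (f (Suc 2) z) \<le> 64"
      by (simp add: f_def norm_divide norm_power pos_divide_le_eq)
  qed (use assms in auto)
  moreover have "(\<Sum>i\<le>2. f i 0 * (w - 0) ^ i / fact i) = w\<^sup>2"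
    by (simp add: f_def numeral_2_eq_2)
  ultimately show ?thesis by (simp add: f_def eval_nat_numeral)
qed

text \<open>Writing \<open>y = x + sqrt N * u\<close> makes the exponent a quadratic in a standard
  normal \<open>u\<close>. Centring by \<open>N\<close> contributes
  \<open>- \<zeta> * (\<alpha> * N)\<close>, which cancels the first-order part of the logarithm;
  the factor \<open>x\<close> in the linear coefficient lets the input enter only through its
  square.\<close>

lemma W_integral_exp_quadratic:
  fixes N \<alpha> \<beta> x :: real and \<zeta> :: complex
  assumes N: "N > 0" and \<zeta>: "norm \<zeta> * \<bar>\<alpha> * N\<bar> < 1/2"
  defines "g \<equiv> \<lambda>y. exp (\<zeta> * of_real (\<alpha> * ((y - x)\<^sup>2 - N) + \<beta> * x * (y - x)))"
  shows "integrable (W N x) g"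
    and "(\<integral>y. g y \<partial>W N x) = exp ((- (1/2) * Ln (1 - 2 * (\<zeta> * (\<alpha> * N))) - \<zeta> * (\<alpha> * N))
        + \<zeta>\<^sup>2 * \<beta>\<^sup>2 * N * x\<^sup>2 / (2 * (1 - 2 * (\<zeta> * (\<alpha> * N)))))"
proof -
  define Q where "Q u = (\<alpha> * N) * u\<^sup>2 + (\<beta> * x * sqrt N) * u" for u
  have [measurable]: "Q \<in> borel_measurable borel" unfolding Q_def by measurable
  have g_eq: "g (x + sqrt N * u) = exp (- (\<zeta> * (\<alpha> * N))) * exp (\<zeta> * of_real (Q u))" for u
  proof -
    have "\<alpha> * ((x + sqrt N * u - x)\<^sup>2 - N) + \<beta> * x * (x + sqrt N * u - x) = Q u - \<alpha> * N"
      using N by (simp add: Q_def power_mult_distrib algebra_simps)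
    then show ?thesis unfolding g_def by (simp add: algebra_simps flip: exp_add)
  qed
  have [measurable]: "g \<in> borel_measurable borel" unfolding g_def by measurable
  have "integrable std_normal_distribution (\<lambda>u. exp (\<zeta> * of_real (Q u)))"
  proof (rule Bochner_Integration.integrable_bound)
    show "integrable std_normal_distribution (\<lambda>u. exp (norm \<zeta> * \<bar>Q u\<bar>))"
      unfolding Q_def using \<zeta> by (intro gaussian_exp_abs_integrable) auto
    show "AE u in std_normal_distribution. norm (exp (\<zeta> * of_real (Q u))) \<le> norm (exp (norm \<zeta> * \<bar>Q u\<bar>))"
    proof (rule AE_I2)
      fix u
      have "Re (\<zeta> * of_real (Q u)) \<le> norm \<zeta> * \<bar>Q u\<bar>"
        using complex_Re_le_cmod[of "\<zeta> * of_real (Q u)"] by (simp add: norm_mult)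
      then show "norm (exp (\<zeta> * of_real (Q u))) \<le> norm (exp (norm \<zeta> * \<bar>Q u\<bar>))"
        by (simp add: norm_exp_eq_Re)
    qed
  qed measurable
  then have I: "integrable std_normal_distribution (\<lambda>u. g (x + sqrt N * u))"
    unfolding g_eq by (rule integrable_mult_right)
  show "integrable (W N x) g"
    unfolding W_eq_distr[OF N] using I by (subst integrable_distr_eq) simp_all
  have "(\<integral>y. g y \<partial>W N x) = (\<integral>u. g (x + sqrt N * u) \<partial>std_normal_distribution)"
    unfolding W_eq_distr[OF N] by (subst integral_distr) simp_all
  also have "\<dots> = exp (- (\<zeta> * (\<alpha> * N))) * (\<integral>u. exp (\<zeta> * of_real (Q u)) \<partial>std_normal_distribution)"
    unfolding g_eq by simp
  also have "(\<integral>u. exp (\<zeta> * of_real (Q u)) \<partial>std_normal_distribution) =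
     exp (- (1/2) * Ln (1 - 2 * \<zeta> * (\<alpha> * N)) + (\<zeta> * (\<beta> * x * sqrt N))\<^sup>2 / (2 * (1 - 2 * \<zeta> * (\<alpha> * N))))"
    unfolding Q_def using gaussian_exp_quadratic_complex[OF \<zeta>, of "\<beta> * x * sqrt N"] by simp
  also have "(\<zeta> * (\<beta> * x * sqrt N))\<^sup>2 = \<zeta>\<^sup>2 * \<beta>\<^sup>2 * N * x\<^sup>2"
    using N by (simp add: power_mult_distrib flip: of_real_power)
  finally show "(\<integral>y. g y \<partial>W N x) = exp ((- (1/2) * Ln (1 - 2 * (\<zeta> * (\<alpha> * N))) - \<zeta> * (\<alpha> * N))
        + \<zeta>\<^sup>2 * \<beta>\<^sup>2 * N * x\<^sup>2 / (2 * (1 - 2 * (\<zeta> * (\<alpha> * N)))))"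
    by (simp add: mult.assoc) (simp add: algebra_simps flip: exp_add)
qed

text \<open>Under \<open>Wn N n x\<close> each summand has mean 0, and variance \<open>2 * (\<alpha>
  * N)\<^sup>2 + \<beta>\<^sup>2 * N * (x j)\<^sup>2\<close>, because the third moment of the noise
  vanishes.\<close>

definition quadratic_sum :: "real \<Rightarrow> real \<Rightarrow> real \<Rightarrow> nat \<Rightarrow> (nat \<Rightarrow> real) \<Rightarrow> (nat \<Rightarrow> real) \<Rightarrow> real" where
  "quadratic_sum N \<alpha> \<beta> n x y = (\<Sum>j<n. \<alpha> * ((y j - x j)\<^sup>2 - N) + \<beta> * x j * (y j - x j))"

lemma quadratic_sum_measurable[measurable]:
  "quadratic_sum N \<alpha> \<beta> n x \<in> borel_measurable (PiM {..<n} (\<lambda>_. borel))"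
  unfolding quadratic_sum_def by measurable

text \<open>By independence the exponents add up, and the input survives only through its total
  power, however that is distributed over the coordinates.\<close>

lemma Wn_integral_exp_quadratic_sum:
  assumes N: "N > 0" and \<zeta>: "norm \<zeta> * \<bar>\<alpha> * N\<bar> < 1/2"
  shows "(\<integral>y. exp (\<zeta> * of_real (quadratic_sum N \<alpha> \<beta> n x y)) \<partial>Wn N n x) =
     exp (of_nat n * (- (1/2) * Ln (1 - 2 * (\<zeta> * (\<alpha> * N))) - \<zeta> * (\<alpha> * N))
        + \<zeta>\<^sup>2 * \<beta>\<^sup>2 * N * (\<Sum>j<n. (x j)\<^sup>2) / (2 * (1 - 2 * (\<zeta> * (\<alpha> * N)))))"
proof -
  interpret product_sigma_finite "\<lambda>j. W N (x j)"
    using prob_space_W[OF N] by (intro product_sigma_finite.intro prob_space_imp_sigma_finite)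
  let ?g = "\<lambda>j y. exp (\<zeta> * of_real (\<alpha> * ((y - x j)\<^sup>2 - N) + \<beta> * x j * (y - x j)))"
  let ?c = "- (1/2) * Ln (1 - 2 * (\<zeta> * (\<alpha> * N))) - \<zeta> * (\<alpha> * N)"
  let ?d = "2 * (1 - 2 * (\<zeta> * (\<alpha> * N)))"
  have "(\<integral>y. exp (\<zeta> * of_real (quadratic_sum N \<alpha> \<beta> n x y)) \<partial>Wn N n x) =
      (\<integral>y. (\<Prod>j<n. ?g j (y j)) \<partial>PiM {..<n} (\<lambda>j. W N (x j)))"
    by (simp add: Wn_def quadratic_sum_def sum_distrib_left exp_sum)
  also have "\<dots> = (\<Prod>j<n. \<integral>y. ?g j y \<partial>W N (x j))"
    by (intro product_integral_prod finite_lessThan W_integral_exp_quadratic(1)[OF N \<zeta>])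
  also have "\<dots> = (\<Prod>j<n. exp (?c + \<zeta>\<^sup>2 * \<beta>\<^sup>2 * N * (x j)\<^sup>2 / ?d))"
    by (intro prod.cong refl W_integral_exp_quadratic(2)[OF N \<zeta>])
  also have "\<dots> = exp (\<Sum>j<n. ?c + \<zeta>\<^sup>2 * \<beta>\<^sup>2 * N * (x j)\<^sup>2 / ?d)"
    by (simp only: exp_sum finite_lessThan)
  also have "(\<Sum>j<n. ?c + \<zeta>\<^sup>2 * \<beta>\<^sup>2 * N * (x j)\<^sup>2 / ?d) =
      of_nat n * ?c + \<zeta>\<^sup>2 * \<beta>\<^sup>2 * N * (\<Sum>j<n. (x j)\<^sup>2) / ?d"
    by (simp add: sum.distrib sum_distrib_left sum_divide_distrib)
  finally show ?thesis by simp
qed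

section \<open>Central limit theorem for quadratic forms\<close>

text \<open>In the limit the logarithms contribute
  \<open>- t\<^sup>2 * (\<alpha> * N)\<^sup>2 / v\<close> to the exponent of the characteristic
  function and the power term contributes
  \<open>- t\<^sup>2 * \<beta>\<^sup>2 * N * p / (2 * v)\<close>. The value of \<open>v\<close>
  makes the sum \<open>- t\<^sup>2 / 2\<close>.\<close>

theorem quadratic_sum_clt:
  fixes m :: "nat \<Rightarrow> nat" and x :: "nat \<Rightarrow> nat \<Rightarrow> real"
  assumes N: "N > 0" and m: "filterlim m at_top sequentially"
    and p: "(\<lambda>k. (\<Sum>j<m k. (x k j)\<^sup>2) / m k) \<longlonglongrightarrow> p"
    and v: "v = 2 * (\<alpha> * N)\<^sup>2 + \<beta>\<^sup>2 * N * p" "v > 0"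
  shows "(\<lambda>k. measure (Wn N (m k) (x k)) {y \<in> space (PiM {..<m k} (\<lambda>_. borel)).
            quadratic_sum N \<alpha> \<beta> (m k) (x k) y \<le> b * sqrt (m k)}) \<longlonglongrightarrow> Gcdf (b / sqrt v)"
proof -
  define T where "T k y = quadratic_sum N \<alpha> \<beta> (m k) (x k) y / sqrt (m k * v)" for k y
  have [measurable]: "T k \<in> borel_measurable (PiM {..<m k} (\<lambda>_. borel))" for k
    unfolding T_def by measurable
  define M where "M k = distr (Wn N (m k) (x k)) borel (T k)" for k
  interpret Wn: prob_space "Wn N n c" for n c by (rule prob_space_Wn[OF N])
  have rd: "real_distribution (M k)" for k
    unfolding M_def by (rule Wn.real_distribution_distr) measurable
  define s where "s k = (\<Sum>j<m k. (x k j)\<^sup>2)" for k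
  define A where "A = \<alpha> * N"
  have "eventually (\<lambda>k. 1 \<le> m k) sequentially"
    using m unfolding filterlim_at_top by blast
  then have mpos: "eventually (\<lambda>k. m k > 0) sequentially" by eventually_elim simp
  have m_inf: "filterlim (\<lambda>k. sqrt (m k)) at_top sequentially"
    by (intro filterlim_compose[OF sqrt_at_top] filterlim_compose[OF filterlim_real_sequentially m])
  have char: "(\<lambda>k. char (M k) t) \<longlonglongrightarrow> char std_normal_distribution t" for t
  proof -
    \<comment> \<open>Dividing by the limiting standard deviation makes
      \<open>of_nat (m k) * (\<zeta> k)\<^sup>2\<close> the constant \<open>- t\<^sup>2 / v\<close>
      as soon as \<open>m k > 0\<close>.\<close>
    define \<zeta> where "\<zeta> k = \<i> * of_real (t / sqrt (m k * v))" for k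
    define w where "w k = \<zeta> k * of_real A" for k
    define r where "r k = of_nat (m k) * (- (1/2) * Ln (1 - 2 * w k) - w k)" for k
    have norm_w: "norm (w k) = (\<bar>t\<bar> * \<bar>A\<bar> / sqrt v) * (1 / sqrt (m k))" for k
      using v(2) by (simp add: w_def \<zeta>_def norm_mult norm_divide real_sqrt_mult field_simps)
    have "(\<lambda>k. (\<bar>t\<bar> * \<bar>A\<bar> / sqrt v) * (1 / sqrt (m k))) \<longlonglongrightarrow> (\<bar>t\<bar> * \<bar>A\<bar> / sqrt v) * 0"
      by (intro tendsto_mult tendsto_const tendsto_divide_0[OF tendsto_const]
          filterlim_mono[OF m_inf at_top_le_at_infinity order_refl])
    then have w0n: "(\<lambda>k. norm (w k)) \<longlonglongrightarrow> 0" unfolding norm_w by simp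
    then have w0: "w \<longlonglongrightarrow> 0" by (rule tendsto_norm_zero_cancel)
    have w_small: "eventually (\<lambda>k. norm (w k) < 1/4) sequentially"
      using order_tendstoD(2)[OF w0n, of "1/4"] by simp
    have \<zeta>sq: "of_nat (m k) * (\<zeta> k)\<^sup>2 = - complex_of_real (t\<^sup>2 / v)" if "m k > 0" for k
    proof -
      have "real (m k) * (t / sqrt (m k * v))\<^sup>2 = t\<^sup>2 / v"
        using that v by (simp add: power_divide)
      moreover have "of_nat (m k) * (\<zeta> k)\<^sup>2 = - of_real (real (m k) * (t / sqrt (m k * v))\<^sup>2)"
        by (simp add: \<zeta>_def power_mult_distrib del: of_real_divide)
      ultimately show ?thesis by (simp only:)
    qed
    have r: "r \<longlonglongrightarrow> - complex_of_real (t\<^sup>2 / v) * (of_real A)\<^sup>2"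
    proof (rule Lim_transform2)
      have "eventually (\<lambda>k. of_nat (m k) * (w k)\<^sup>2 = - complex_of_real (t\<^sup>2 / v) * (of_real A)\<^sup>2) sequentially"
        using mpos by eventually_elim (simp add: w_def power_mult_distrib \<zeta>sq flip: mult.assoc)
      then show "(\<lambda>k. of_nat (m k) * (w k)\<^sup>2) \<longlonglongrightarrow> - complex_of_real (t\<^sup>2 / v) * (of_real A)\<^sup>2"
        by (rule tendsto_eventually)
      \<comment> \<open>The cubic remainder is multiplied by \<open>m k\<close>. Since
        \<open>m k * (norm (w k))\<^sup>2\<close> is constant, one factor \<open>norm (w k)\<close>
        is left over, and it tends to 0.\<close>
      show "(\<lambda>k. of_nat (m k) * (w k)\<^sup>2 - r k) \<longlonglongrightarrow> 0"
      proof (rule Lim_null_comparison)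
        show "eventually (\<lambda>k. norm (of_nat (m k) * (w k)\<^sup>2 - r k) \<le>
            32 * (t\<^sup>2 * A\<^sup>2 / v) * norm (w k)) sequentially"
          using w_small mpos
        proof eventually_elim
          case (elim k)
          have "of_nat (m k) * (w k)\<^sup>2 - r k = - (of_nat (m k) * (- (1/2) * Ln (1 - 2 * w k) - w k - (w k)\<^sup>2))"
            by (simp add: r_def algebra_simps)
          then have "norm (of_nat (m k) * (w k)\<^sup>2 - r k) \<le> m k * (32 * norm (w k) ^ 3)"
            using minus_half_Ln_approx[OF elim(1)] by (simp only: norm_minus_cancel norm_mult norm_of_nat) (rule mult_left_mono, simp_all)
          also have "\<dots> = 32 * (m k * (norm (w k))\<^sup>2) * norm (w k)"
            by (simp add: power2_eq_square power3_eq_cube)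
          also have "m k * (norm (w k))\<^sup>2 = t\<^sup>2 * A\<^sup>2 / v"
            unfolding norm_w using elim(2) v by (simp add: power_mult_distrib power_divide)
          finally show ?case .
        qed
        show "(\<lambda>k. 32 * (t\<^sup>2 * A\<^sup>2 / v) * norm (w k)) \<longlonglongrightarrow> 0"
          using tendsto_mult_right_zero[OF w0n] by blast
      qed
    qed
    have q: "(\<lambda>k. (\<zeta> k)\<^sup>2 * \<beta>\<^sup>2 * N * complex_of_real (s k) / (2 * (1 - 2 * w k)))
        \<longlonglongrightarrow> - complex_of_real (t\<^sup>2 / v) * \<beta>\<^sup>2 * N * complex_of_real p / (2 * (1 - 2 * 0))"
    proof -
      have "(\<lambda>k. - complex_of_real (t\<^sup>2 / v) * \<beta>\<^sup>2 * N * complex_of_real (s k / m k) / (2 * (1 - 2 * w k)))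
        \<longlonglongrightarrow> - complex_of_real (t\<^sup>2 / v) * \<beta>\<^sup>2 * N * complex_of_real p / (2 * (1 - 2 * 0))"
        by (intro tendsto_intros p[folded s_def] w0) simp
      moreover have "eventually (\<lambda>k. - complex_of_real (t\<^sup>2 / v) * \<beta>\<^sup>2 * N * complex_of_real (s k / m k) / (2 * (1 - 2 * w k))
         = (\<zeta> k)\<^sup>2 * \<beta>\<^sup>2 * N * complex_of_real (s k) / (2 * (1 - 2 * w k))) sequentially"
        using mpos
      proof eventually_elim
        case (elim k)
        then show ?case unfolding \<zeta>sq[OF elim, symmetric] by simp
      qed
      ultimately show ?thesis by (rule Lim_transform_eventually)
    qed
    have "(\<lambda>k. exp (r k + (\<zeta> k)\<^sup>2 * \<beta>\<^sup>2 * N * complex_of_real (s k) / (2 * (1 - 2 * w k))))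
       \<longlonglongrightarrow> exp (- complex_of_real (t\<^sup>2 / v) * (of_real A)\<^sup>2 + - complex_of_real (t\<^sup>2 / v) * \<beta>\<^sup>2 * N * complex_of_real p / (2 * (1 - 2 * 0)))"
      by (intro tendsto_exp tendsto_add r q)
    also have "- complex_of_real (t\<^sup>2 / v) * (of_real A)\<^sup>2 + - complex_of_real (t\<^sup>2 / v) * \<beta>\<^sup>2 * N * complex_of_real p / (2 * (1 - 2 * 0))
      = (of_real (- (t\<^sup>2 / v) * (v / 2)) :: complex)"
    proof -
      define c where "c = t\<^sup>2 / v"
      have e: "v / 2 = A\<^sup>2 + \<beta>\<^sup>2 * N * p / 2" using v(1) by (simp add: A_def)
      show ?thesis unfolding e c_def[symmetric] by (simp add: algebra_simps)
    qed
    also have "- (t\<^sup>2 / v) * (v / 2) = - (t\<^sup>2) / 2" using v(2) by simp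
    finally have lim: "(\<lambda>k. exp (r k + (\<zeta> k)\<^sup>2 * \<beta>\<^sup>2 * N * complex_of_real (s k) / (2 * (1 - 2 * w k))))
       \<longlonglongrightarrow> char std_normal_distribution t"
      by (simp only: char_std_normal_distribution exp_of_real)
    moreover have "eventually (\<lambda>k. exp (r k + (\<zeta> k)\<^sup>2 * \<beta>\<^sup>2 * N * complex_of_real (s k) / (2 * (1 - 2 * w k)))
        = char (M k) t) sequentially"
      using w_small
    proof eventually_elim
      case (elim k)
      have "norm (w k) = norm (\<zeta> k) * \<bar>\<alpha> * N\<bar>"
        by (simp only: w_def A_def norm_mult norm_of_real)
      then have *: "norm (\<zeta> k) * \<bar>\<alpha> * N\<bar> < 1/2"
        using elim by linarith
      have "char (M k) t = (\<integral>y. iexp (t * T k y) \<partial>Wn N (m k) (x k))"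
        unfolding char_def M_def by (subst integral_distr) simp_all
      also have "\<dots> = (\<integral>y. exp (\<zeta> k * of_real (quadratic_sum N \<alpha> \<beta> (m k) (x k) y)) \<partial>Wn N (m k) (x k))"
        by (simp add: T_def \<zeta>_def mult.assoc)
      also have "\<dots> = exp (r k + (\<zeta> k)\<^sup>2 * \<beta>\<^sup>2 * N * complex_of_real (s k) / (2 * (1 - 2 * w k)))"
        unfolding Wn_integral_exp_quadratic_sum[OF N *] r_def s_def w_def A_def by simp
      finally show ?case by simp
    qed
    ultimately show ?thesis by (rule Lim_transform_eventually)
  qed
  have conv: "weak_conv_m M std_normal_distribution"
    by (rule levy_continuity[OF rd real_dist_normal_dist char])
  have "(\<lambda>k. cdf (M k) (b / sqrt v)) \<longlonglongrightarrow> Gcdf (b / sqrt v)"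
    using conv isCont_Gcdf by (simp add: weak_conv_m_def weak_conv_def Gcdf_eq_cdf)
  moreover have "eventually (\<lambda>k. cdf (M k) (b / sqrt v) = measure (Wn N (m k) (x k)) {y \<in> space (PiM {..<m k} (\<lambda>_. borel)).
            quadratic_sum N \<alpha> \<beta> (m k) (x k) y \<le> b * sqrt (m k)}) sequentially"
    using mpos
  proof eventually_elim
    case (elim k)
    have "T k y \<le> b / sqrt v \<longleftrightarrow> quadratic_sum N \<alpha> \<beta> (m k) (x k) y \<le> b * sqrt (m k)" for y
      using elim v(2) by (simp add: T_def real_sqrt_mult field_simps)
    then show ?case
      unfolding cdf_def M_def by (subst measure_distr) (auto intro!: arg_cong[where f="measure _"])
  qed
  ultimately show ?thesis by (rule Lim_transform_eventually)
qed

section \<open>Information density\<close>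

text \<open>Boxes determine a product measure; on a box the indicator is a product of coordinate
  indicators, so the integral of the product density factorises.\<close>

lemma PiM_density:
  fixes M :: "'i \<Rightarrow> 'a measure" and f :: "'i \<Rightarrow> 'a \<Rightarrow> ennreal"
  assumes I: "finite I" and M: "\<And>i. sigma_finite_measure (M i)"
    and f[measurable]: "\<And>i. f i \<in> borel_measurable (M i)"
    and df: "\<And>i. sigma_finite_measure (density (M i) (f i))"
  shows "PiM I (\<lambda>i. density (M i) (f i)) = density (PiM I M) (\<lambda>y. \<Prod>i\<in>I. f i (y i))"
proof -
  interpret M: product_sigma_finite M by (rule product_sigma_finite.intro) (rule M)
  interpret D: product_sigma_finite "\<lambda>i. density (M i) (f i)"
    by (rule product_sigma_finite.intro) (rule df)
  show ?thesis
  proof (rule D.PiM_eqI[OF I, symmetric])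
    show "sets (density (PiM I M) (\<lambda>y. \<Prod>i\<in>I. f i (y i))) = sets (PiM I (\<lambda>i. density (M i) (f i)))"
      by (auto intro!: sets_PiM_cong)
  next
    fix A assume A: "\<And>i. i \<in> I \<Longrightarrow> A i \<in> sets (density (M i) (f i))"
    have ind: "indicator (Pi\<^sub>E I A) y = (\<Prod>i\<in>I. indicator (A i) (y i) :: ennreal)" if y: "y \<in> space (PiM I M)" for y
    proof (cases "y \<in> Pi\<^sub>E I A")
      case True then show ?thesis by (auto simp: PiE_iff)
    next
      case False
      then obtain i where "i \<in> I" "y i \<notin> A i" using y by (auto simp: PiE_iff space_PiM)
      then have "(\<Prod>i\<in>I. indicator (A i) (y i) :: ennreal) = 0" using I by (intro prod_zero) (auto intro!: bexI[of _ i])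
      then show ?thesis using False by simp
    qed
    have "emeasure (density (PiM I M) (\<lambda>y. \<Prod>i\<in>I. f i (y i))) (Pi\<^sub>E I A) =
       (\<integral>\<^sup>+y. (\<Prod>i\<in>I. f i (y i)) * indicator (Pi\<^sub>E I A) y \<partial>PiM I M)"
      using A I by (intro emeasure_density) (auto intro!: sets_PiM_I_finite)
    also have "\<dots> = (\<integral>\<^sup>+y. (\<Prod>i\<in>I. f i (y i) * indicator (A i) (y i)) \<partial>PiM I M)"
      by (intro nn_integral_cong) (simp add: ind prod.distrib)
    also have "\<dots> = (\<Prod>i\<in>I. \<integral>\<^sup>+y. f i y * indicator (A i) y \<partial>M i)"
      using A by (intro M.product_nn_integral_prod I) auto
    also have "\<dots> = (\<Prod>i\<in>I. emeasure (density (M i) (f i)) (A i))"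
      using A by (intro prod.cong refl emeasure_density[symmetric]) auto
    finally show "emeasure (density (PiM I M) (\<lambda>y. \<Prod>i\<in>I. f i (y i))) (Pi\<^sub>E I A) =
        (\<Prod>i\<in>I. emeasure (density (M i) (f i)) (A i))" .
  qed
qed

lemma Wn_density_lborel:
  assumes "N > 0"
  shows "Wn N n x = density (PiM {..<n} (\<lambda>_. lborel)) (\<lambda>y. \<Prod>j<n. ennreal (normal_density (x j) (sqrt N) (y j)))"
  unfolding Wn_def W_def using prob_space_W[OF assms]
  by (intro PiM_density) (auto intro!: sigma_finite_lborel prob_space_imp_sigma_finite simp: W_def)

text \<open>This is the logarithm of the density of \<open>Wn N n x\<close> with respect to
  \<open>Wn (N + S) n (\<lambda>_. 0)\<close>. The constant comes from the normalising factors of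
  the two normal densities: \<open>exp (CG N S) = sqrt (N + S) / sqrt N\<close>.\<close>

definition info_density :: "real \<Rightarrow> real \<Rightarrow> nat \<Rightarrow> (nat \<Rightarrow> real) \<Rightarrow> (nat \<Rightarrow> real) \<Rightarrow> real" where
  "info_density N S n x y = (\<Sum>j<n. CG N S - (y j - x j)\<^sup>2 / (2 * N) + (y j)\<^sup>2 / (2 * (N + S)))"

lemma info_density_measurable[measurable]:
  "info_density N S n x \<in> borel_measurable (PiM {..<n} (\<lambda>_. borel))"
  unfolding info_density_def by measurable

lemma measure_info_density_greater:
  assumes "N > 0"
  shows "measure (Wn N n x) {y \<in> space (PiM {..<n} (\<lambda>_. borel)). info_density N S n x y > t} =
    1 - measure (Wn N n x) {y \<in> space (PiM {..<n} (\<lambda>_. borel)). info_density N S n x y \<le> t}"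
proof -
  interpret Wx: prob_space "Wn N n x" by (rule prob_space_Wn[OF assms])
  have "{y \<in> space (PiM {..<n} (\<lambda>_. borel)). info_density N S n x y > t} =
     space (Wn N n x) - {y \<in> space (PiM {..<n} (\<lambda>_. borel)). info_density N S n x y \<le> t}"
    by auto
  then show ?thesis by (simp only:) (rule Wx.prob_compl, simp)
qed

lemma W_density_W:
  assumes "N > 0" "S > 0"
  shows "W N x = density (W (N + S) 0) (\<lambda>y. ennreal (exp (CG N S - (y - x)\<^sup>2 / (2 * N) + y\<^sup>2 / (2 * (N + S)))))"
proof -
  have eq: "normal_density x (sqrt N) y =
      normal_density 0 (sqrt (N + S)) y * exp (CG N S - (y - x)\<^sup>2 / (2 * N) + y\<^sup>2 / (2 * (N + S)))" for y
  proof -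
    have "exp (CG N S) = sqrt (1 + S / N)"
      using assms by (simp add: CG_def ln_sqrt[symmetric] add_pos_pos)
    also have "1 + S / N = (N + S) / N" using assms by (simp add: field_simps)
    finally have "exp (CG N S) = sqrt (N + S) / sqrt N" by (simp add: real_sqrt_divide)
    moreover have "exp (- (y - 0)\<^sup>2 / (2 * (N + S))) *
        exp (CG N S - (y - x)\<^sup>2 / (2 * N) + y\<^sup>2 / (2 * (N + S))) = exp (CG N S) * exp (- (y - x)\<^sup>2 / (2 * N))"
      by (simp flip: exp_add)
    ultimately have "exp (- (y - 0)\<^sup>2 / (2 * (N + S))) *
        exp (CG N S - (y - x)\<^sup>2 / (2 * N) + y\<^sup>2 / (2 * (N + S))) =
        sqrt (N + S) / sqrt N * exp (- (y - x)\<^sup>2 / (2 * N))"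
      by (simp only:)
    then have "1 / sqrt (2 * pi * (N + S)) * (exp (- (y - 0)\<^sup>2 / (2 * (N + S))) *
        exp (CG N S - (y - x)\<^sup>2 / (2 * N) + y\<^sup>2 / (2 * (N + S)))) =
        1 / sqrt (2 * pi * N) * exp (- (y - x)\<^sup>2 / (2 * N))"
      using assms by (simp only: real_sqrt_mult) simp
    then show ?thesis
      using assms by (simp add: normal_density_def)
  qed
  show ?thesis
    unfolding W_def by (subst density_density_eq) (simp_all add: eq ennreal_mult')
qed

lemma Wn_density_Wn:
  assumes "N > 0" "S > 0"
  shows "Wn N n x = density (Wn (N + S) n (\<lambda>_. 0)) (\<lambda>y. ennreal (exp (info_density N S n x y)))"
proof -
  let ?f = "\<lambda>j y. ennreal (exp (CG N S - (y - x j)\<^sup>2 / (2 * N) + y\<^sup>2 / (2 * (N + S))))"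
  have "Wn N n x = PiM {..<n} (\<lambda>j. density (W (N + S) 0) (?f j))"
    unfolding Wn_def W_density_W[OF assms] ..
  also have "\<dots> = density (PiM {..<n} (\<lambda>j. W (N + S) 0)) (\<lambda>y. \<Prod>j<n. ?f j (y j))"
  proof (rule PiM_density)
    show "sigma_finite_measure (density (W (N + S) 0) (?f j))" for j
      unfolding W_density_W[OF assms, symmetric]
      using assms by (intro prob_space_imp_sigma_finite prob_space_W)
  qed (use assms in \<open>auto intro!: prob_space_imp_sigma_finite prob_space_W\<close>)
  also have "(\<lambda>y. \<Prod>j<n. ?f j (y j)) = (\<lambda>y. ennreal (exp (info_density N S n x y)))"
    by (simp add: info_density_def exp_sum prod_ennreal)
  finally show ?thesis by (simp add: Wn_def)
qed

text \<open>On this event the density of \<open>Wn N n x\<close> exceeds \<open>exp t\<close>, while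
  its total mass is 1. The bound is the same for every input, so it can serve as the price of one
  decoding set in the greedy construction.\<close>

lemma Wn_info_density_greater:
  assumes "N > 0" "S > 0"
  shows "measure (Wn (N + S) n (\<lambda>_. 0)) {y \<in> space (PiM {..<n} (\<lambda>_. borel)). info_density N S n x y > t} \<le> exp (- t)"
proof -
  let ?Q = "Wn (N + S) n (\<lambda>_. 0)"
  let ?B = "{y \<in> space (PiM {..<n} (\<lambda>_. borel)). info_density N S n x y > t}"
  interpret Q: prob_space ?Q using assms by (intro prob_space_Wn) simp
  interpret Wx: prob_space "Wn N n x" using assms by (intro prob_space_Wn) simp
  have "ennreal (exp t) * emeasure ?Q ?B = (\<integral>\<^sup>+y. ennreal (exp t) * indicator ?B y \<partial>?Q)"
    by (simp add: nn_integral_cmult_indicator)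
  also have "\<dots> \<le> (\<integral>\<^sup>+y. ennreal (exp (info_density N S n x y)) * indicator ?B y \<partial>?Q)"
    by (intro nn_integral_mono) (auto simp: indicator_def intro!: ennreal_leI)
  also have "\<dots> = emeasure (Wn N n x) ?B"
    unfolding Wn_density_Wn[OF assms, of n x] by (subst emeasure_density) simp_all
  also have "\<dots> \<le> 1" by (rule Wx.emeasure_le_1)
  finally have "exp t * measure ?Q ?B \<le> 1"
    by (simp add: Q.emeasure_eq_measure flip: ennreal_mult)
  then show ?thesis by (simp add: exp_minus field_simps)
qed

text \<open>Cut \<open>D\<close> along the event: off it the density with respect to the reference
  law is at most \<open>exp t\<close>.\<close>

lemma Wn_le_info_density:
  assumes "N > 0" "S > 0" and D[measurable]: "D \<in> sets (PiM {..<n} (\<lambda>_. borel))"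
  shows "measure (Wn N n x) D \<le> measure (Wn N n x) {y \<in> space (PiM {..<n} (\<lambda>_. borel)). info_density N S n x y > t}
            + exp t * measure (Wn (N + S) n (\<lambda>_. 0)) D"
proof -
  let ?Q = "Wn (N + S) n (\<lambda>_. 0)"
  let ?B = "{y \<in> space (PiM {..<n} (\<lambda>_. borel)). info_density N S n x y > t}"
  interpret Q: prob_space ?Q using assms by (intro prob_space_Wn) simp
  interpret Wx: prob_space "Wn N n x" using assms by (intro prob_space_Wn) simp
  have "emeasure (Wn N n x) (D - ?B) = (\<integral>\<^sup>+y. ennreal (exp (info_density N S n x y)) * indicator (D - ?B) y \<partial>?Q)"
    unfolding Wn_density_Wn[OF assms(1,2), of n x] by (subst emeasure_density) simp_all
  also have "\<dots> \<le> (\<integral>\<^sup>+y. ennreal (exp t) * indicator D y \<partial>?Q)"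
    using sets.sets_into_space[OF D]
    by (intro nn_integral_mono) (auto simp: indicator_def intro!: ennreal_leI)
  also have "\<dots> = ennreal (exp t) * emeasure ?Q D"
    by (simp add: nn_integral_cmult_indicator)
  finally have "measure (Wn N n x) (D - ?B) \<le> exp t * measure ?Q D"
    by (simp add: Q.emeasure_eq_measure Wx.emeasure_eq_measure flip: ennreal_mult)
  moreover have "measure (Wn N n x) D \<le> measure (Wn N n x) (?B \<union> (D - ?B))"
    by (intro Wx.finite_measure_mono) auto
  moreover have "measure (Wn N n x) (?B \<union> (D - ?B)) \<le> measure (Wn N n x) ?B + measure (Wn N n x) (D - ?B)"
    by (intro measure_Un_le) auto
  ultimately show ?thesis by linarith
qed

lemma info_density_eq_quadratic_sum:
  assumes "N > 0" "S > 0"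
  shows "info_density N S n x y = n * CG N S
     + quadratic_sum N (- S / (2 * N * (N + S))) (1 / (N + S)) n x y
     - (n * S - (\<Sum>j<n. (x j)\<^sup>2)) / (2 * (N + S))"
proof -
  have "CG N S - (b - a)\<^sup>2 / (2 * N) + b\<^sup>2 / (2 * (N + S)) = CG N S
      + (- S / (2 * N * (N + S)) * ((b - a)\<^sup>2 - N) + 1 / (N + S) * a * (b - a))
      - (S - a\<^sup>2) / (2 * (N + S))" for a b
  proof -
    have "N + S \<noteq> 0" "N \<noteq> 0" using assms by auto
    then show ?thesis by (simp add: divide_simps power2_eq_square) (simp add: algebra_simps)
  qed
  then have "info_density N S n x y = (\<Sum>j<n. CG N S
      + (- S / (2 * N * (N + S)) * ((y j - x j)\<^sup>2 - N) + 1 / (N + S) * x j * (y j - x j))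
      - (S - (x j)\<^sup>2) / (2 * (N + S)))"
    by (simp only: info_density_def)
  also have "\<dots> = n * CG N S
     + quadratic_sum N (- S / (2 * N * (N + S))) (1 / (N + S)) n x y
     - (\<Sum>j<n. (S - (x j)\<^sup>2)) / (2 * (N + S))"
    by (simp only: quadratic_sum_def sum.distrib sum_subtractf sum_divide_distrib[symmetric] sum_constant card_lessThan of_nat_id)
  finally show ?thesis by (simp add: sum_subtractf)
qed

text \<open>The transition density depends only on \<open>y j - x j\<close>, so after exchanging the
  integrals each coordinate is a convolution of two centred normal densities, whose variances
  add.\<close>

lemma Wn_convolution:
  assumes N: "N > 0" and S: "S > 0" and D[measurable]: "D \<in> sets (PiM {..<n} (\<lambda>_. borel))"
  shows "(\<integral>\<^sup>+x. emeasure (Wn N n x) D \<partial>Wn S n (\<lambda>_. 0)) = emeasure (Wn (N + S) n (\<lambda>_. 0)) D"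
proof -
  let ?L = "PiM {..<n} (\<lambda>_. lborel :: real measure)"
  interpret PS: product_sigma_finite "\<lambda>_::nat. lborel :: real measure"
    by (intro product_sigma_finite.intro sigma_finite_lborel)
  interpret L: sigma_finite_measure ?L by (intro PS.sigma_finite finite_lessThan)
  interpret LL: pair_sigma_finite ?L ?L ..
  have [measurable_cong]: "sets ?L = sets (PiM {..<n} (\<lambda>_. borel))" by (intro sets_PiM_cong) auto
  have nd: "normal_density a s b = normal_density 0 s (b - a)" for a s b :: real
    by (simp add: normal_density_def)
  let ?w = "\<lambda>x y. \<Prod>j<n. ennreal (normal_density 0 (sqrt N) (y j - x j))"
  have [measurable]: "(\<lambda>p. ?w (fst p) (snd p)) \<in> borel_measurable (?L \<Otimes>\<^sub>M ?L)"
    by measurable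
  have W: "emeasure (Wn N n x) D = (\<integral>\<^sup>+y. ?w x y * indicator D y \<partial>?L)" for x
    unfolding Wn_density_lborel[OF N] nd[of "x _"]
    by (subst emeasure_density) auto
  have m: "(\<lambda>x. \<integral>\<^sup>+y. ?w x y * indicator D y \<partial>?L) \<in> borel_measurable ?L"
    by measurable
  let ?g = "\<lambda>x. \<Prod>j<n. ennreal (normal_density 0 (sqrt S) (x j))"
  have "(\<integral>\<^sup>+x. emeasure (Wn N n x) D \<partial>Wn S n (\<lambda>_. 0)) = (\<integral>\<^sup>+x. ?g x * (\<integral>\<^sup>+y. ?w x y * indicator D y \<partial>?L) \<partial>?L)"
    unfolding W Wn_density_lborel[OF S] by (subst nn_integral_density) (use m in auto)
  also have "\<dots> = (\<integral>\<^sup>+x. (\<integral>\<^sup>+y. ?g x * (?w x y * indicator D y) \<partial>?L) \<partial>?L)"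
    by (intro nn_integral_cong nn_integral_cmult[symmetric]) measurable
  also have "\<dots> = (\<integral>\<^sup>+y. (\<integral>\<^sup>+x. ?g x * (?w x y * indicator D y) \<partial>?L) \<partial>?L)"
    by (rule LL.Fubini') measurable
  also have "\<dots> = (\<integral>\<^sup>+y. (\<Prod>j<n. ennreal (normal_density 0 (sqrt (N + S)) (y j))) * indicator D y \<partial>?L)"
  proof (intro nn_integral_cong)
    fix y
    have "(\<integral>\<^sup>+x. ?g x * (?w x y * indicator D y) \<partial>?L) =
        (\<integral>\<^sup>+x. (\<Prod>j<n. ennreal (normal_density 0 (sqrt N) (y j - x j) * normal_density 0 (sqrt S) (x j))) * indicator D y \<partial>?L)"
      by (intro nn_integral_cong) (simp add: ennreal_mult' prod.distrib mult_ac)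
    also have "\<dots> = (\<integral>\<^sup>+x. (\<Prod>j<n. ennreal (normal_density 0 (sqrt N) (y j - x j) * normal_density 0 (sqrt S) (x j))) \<partial>?L) * indicator D y"
      by (intro nn_integral_multc) measurable
    also have "(\<integral>\<^sup>+x. (\<Prod>j<n. ennreal (normal_density 0 (sqrt N) (y j - x j) * normal_density 0 (sqrt S) (x j))) \<partial>?L)
        = (\<Prod>j<n. \<integral>\<^sup>+x. ennreal (normal_density 0 (sqrt N) (y j - x) * normal_density 0 (sqrt S) x) \<partial>lborel)"
      by (intro PS.product_nn_integral_prod) auto
    also have "\<dots> = (\<Prod>j<n. ennreal (normal_density 0 (sqrt (N + S)) (y j)))"
      using fun_cong[OF conv_normal_density_zero_mean[of "sqrt N" "sqrt S"]] N S by (intro prod.cong) auto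
    finally show "(\<integral>\<^sup>+x. ?g x * (?w x y * indicator D y) \<partial>?L) =
        (\<Prod>j<n. ennreal (normal_density 0 (sqrt (N + S)) (y j))) * indicator D y" .
  qed
  also have "\<dots> = emeasure (Wn (N + S) n (\<lambda>_. 0)) D"
    using N S by (subst Wn_density_lborel) (auto simp: emeasure_density)
  finally show ?thesis .
qed

section \<open>Limit law of the information density, uniformly over the inputs\<close>

lemma dispersion_pos: "N > 0 \<Longrightarrow> S > 0 \<Longrightarrow> dispersion N S > 0"
  unfolding dispersion_def by (intro divide_pos_pos add_pos_pos mult_pos_pos zero_less_power) auto

text \<open>The left side is the limiting variance
  \<open>2 * (\<alpha> * N)\<^sup>2 + \<beta>\<^sup>2 * N * p\<close> for the coefficients of the
  information density at full power \<open>p = S\<close>; this is the origin of the constant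
  V.\<close>

lemma dispersion_eq:
  assumes "N > 0" "S > 0"
  shows "2 * (- S / (2 * N * (N + S)) * N)\<^sup>2 + (1 / (N + S))\<^sup>2 * N * S = dispersion N S"
proof -
  have e: "1 + S / N = (N + S) / N" using assms by (simp add: field_simps)
  have "N + S \<noteq> 0" "N \<noteq> 0" using assms by auto
  then show ?thesis unfolding dispersion_def e by (simp add: divide_simps power2_eq_square) (simp add: algebra_simps)
qed

lemma info_density_le_iff:
  assumes "N > 0" "S > 0"
  shows "info_density N S n x y \<le> n * CG N S + b * sqrt n \<longleftrightarrow>
    quadratic_sum N (- S / (2 * N * (N + S))) (1 / (N + S)) n x y
      \<le> b * sqrt n + (n * S - (\<Sum>j<n. (x j)\<^sup>2)) / (2 * (N + S))"
  unfolding info_density_eq_quadratic_sum[OF assms] by linarith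

text \<open>The squared noise alone has positive variance, so the limit is nondegenerate for every
  limiting power \<open>p\<close>, including 0.\<close>

lemma info_density_quadratic_sum_clt:
  fixes m :: "nat \<Rightarrow> nat" and x :: "nat \<Rightarrow> nat \<Rightarrow> real"
  assumes "N > 0" "S > 0" "filterlim m at_top sequentially"
    "(\<lambda>k. (\<Sum>j<m k. (x k j)\<^sup>2) / m k) \<longlonglongrightarrow> p" "p \<ge> 0"
  defines "v \<equiv> 2 * (- S / (2 * N * (N + S)) * N)\<^sup>2 + (1 / (N + S))\<^sup>2 * N * p"
  shows "v > 0" "(\<lambda>k. measure (Wn N (m k) (x k)) {y \<in> space (PiM {..<m k} (\<lambda>_. borel)).
            quadratic_sum N (- S / (2 * N * (N + S))) (1 / (N + S)) (m k) (x k) y \<le> b * sqrt (m k)}) \<longlonglongrightarrow> Gcdf (b / sqrt v)"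
proof -
  show "v > 0" unfolding v_def using assms by (intro add_pos_nonneg) auto
  then show "(\<lambda>k. measure (Wn N (m k) (x k)) {y \<in> space (PiM {..<m k} (\<lambda>_. borel)).
            quadratic_sum N (- S / (2 * N * (N + S))) (1 / (N + S)) (m k) (x k) y \<le> b * sqrt (m k)}) \<longlonglongrightarrow> Gcdf (b / sqrt v)"
    using quadratic_sum_clt[OF assms(1,3,4) v_def[THEN meta_eq_to_obj_eq]] by simp
qed

text \<open>Counterexamples at arbitrarily large block lengths would have normalised powers in the
  compact interval \<open>{0..S}\<close>. Along a subsequence with limit \<open>l\<close> the limit
  theorem applies and refutes them.\<close>

lemma info_density_lower_tail_ge:
  fixes N S \<eta> b :: real
  assumes N: "N > 0" and S: "S > 0" and \<eta>: "\<eta> > 0"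
  shows "\<forall>\<^sub>F n in sequentially. \<forall>x. (\<Sum>j<n. (x j)\<^sup>2) \<le> n * S \<longrightarrow>
     measure (Wn N n x) {y \<in> space (PiM {..<n} (\<lambda>_. borel)). info_density N S n x y \<le> n * CG N S + b * sqrt n}
       \<ge> Gcdf (b / sqrt (dispersion N S)) - \<eta>"
    (is "\<forall>\<^sub>F n in sequentially. \<forall>x. ?pow n x \<longrightarrow> ?P n x \<ge> ?g - \<eta>")
proof (rule ccontr)
  assume "\<not> ?thesis"
  then have "\<forall>k. \<exists>n x. n \<ge> k \<and> ?pow n x \<and> ?P n x < ?g - \<eta>"
    by (auto simp: eventually_sequentially not_le)
  from choice[OF this] obtain m where "\<forall>k. \<exists>x. m k \<ge> k \<and> ?pow (m k) x \<and> ?P (m k) x < ?g - \<eta>" by blast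
  from choice[OF this] obtain x where m: "\<And>k. m k \<ge> k" and pow: "\<And>k. ?pow (m k) (x k)"
    and bad: "\<And>k. ?P (m k) (x k) < ?g - \<eta>" by blast
  define p where "p k = (\<Sum>j<m k. (x k j)\<^sup>2) / m k" for k
  have "p k \<in> {0..S}" for k
    using pow[of k] S by (cases "m k = 0") (auto simp: p_def sum_nonneg field_simps)
  then obtain l r where l: "l \<in> {0..S}" and r: "strict_mono r" and pl: "(p \<circ> r) \<longlonglongrightarrow> l"
    using compact_imp_seq_compact[OF compact_Icc[of 0 S]] unfolding seq_compact_def by metis
  have minf: "filterlim (m \<circ> r) at_top sequentially"
  proof (rule filterlim_at_top_mono[OF filterlim_ident])
    show "\<forall>\<^sub>F k in sequentially. k \<le> (m \<circ> r) k"
      using m seq_suble[OF r] by (auto intro: order_trans always_eventually)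
  qed
  define v where "v = 2 * (- S / (2 * N * (N + S)) * N)\<^sup>2 + (1 / (N + S))\<^sup>2 * N * l"
  have lim: "(\<lambda>k. (\<Sum>j<(m \<circ> r) k. ((x \<circ> r) k j)\<^sup>2) / (m \<circ> r) k) \<longlonglongrightarrow> l"
    using pl by (simp add: p_def o_def)
  have v: "v > 0" and clt: "(\<lambda>k. measure (Wn N ((m \<circ> r) k) ((x \<circ> r) k)) {y \<in> space (PiM {..<(m \<circ> r) k} (\<lambda>_. borel)).
            quadratic_sum N (- S / (2 * N * (N + S))) (1 / (N + S)) ((m \<circ> r) k) ((x \<circ> r) k) y \<le> b' * sqrt ((m \<circ> r) k)})
            \<longlonglongrightarrow> Gcdf (b' / sqrt v)" for b'
    unfolding v_def using info_density_quadratic_sum_clt[OF N S minf lim] l by auto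
  have sqrt_inf: "filterlim (\<lambda>k. sqrt ((m \<circ> r) k)) at_top sequentially"
    by (intro filterlim_compose[OF sqrt_at_top] filterlim_compose[OF filterlim_real_sequentially minf])
  \<comment> \<open>A threshold for the centred form that is covered by \<open>b\<close> together
    with the power deficit. If \<open>l = S\<close>, the deficit is merely nonnegative, but the
    variance is the dispersion and \<open>b' = b\<close> works. If \<open>l < S\<close>, the deficit
    has order n and covers any \<open>b'\<close>, which is taken so large that the limit exceeds
    \<open>?g - \<eta>\<close>, a number below 1.\<close>
  obtain b' where b': "Gcdf (b' / sqrt v) > ?g - \<eta>"
    and ev: "\<forall>\<^sub>F k in sequentially. b' \<le> b + sqrt ((m \<circ> r) k) * ((S - (p \<circ> r) k) / (2 * (N + S)))"
  proof (cases "l = S")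
    case True
    have "v = dispersion N S" using dispersion_eq[OF N S] by (simp add: v_def True)
    moreover have "(p \<circ> r) k \<le> S" for k using \<open>\<And>k. p k \<in> {0..S}\<close> by simp
    ultimately show ?thesis using \<eta> N S by (intro that[of b]) (auto intro!: always_eventually)
  next
    case False
    then have lS: "l < S" using l by simp
    have "filterlim (\<lambda>t. (1 / sqrt v) * t) at_top at_top"
      using v by (intro filterlim_tendsto_pos_mult_at_top[OF tendsto_const] filterlim_ident) simp
    then have "((\<lambda>t. Gcdf (t / sqrt v)) \<longlongrightarrow> 1) at_top"
      using filterlim_compose[OF Gcdf_at_top] by simp
    moreover have "?g - \<eta> < 1" using Gcdf_le_1[of "b / sqrt (dispersion N S)"] \<eta> by linarith
    ultimately have "\<forall>\<^sub>F t in at_top. Gcdf (t / sqrt v) > ?g - \<eta>" by (rule order_tendstoD(1))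
    then obtain b' where b': "Gcdf (b' / sqrt v) > ?g - \<eta>" by (auto simp: eventually_at_top_linorder)
    have "(\<lambda>k. (S - (p \<circ> r) k) / (2 * (N + S))) \<longlonglongrightarrow> (S - l) / (2 * (N + S))"
      using N S by (intro tendsto_intros pl) auto
    moreover have "(S - l) / (2 * (N + S)) > 0" using lS N S by simp
    ultimately have "filterlim (\<lambda>k. (S - (p \<circ> r) k) / (2 * (N + S)) * sqrt ((m \<circ> r) k)) at_top sequentially"
      by (intro filterlim_tendsto_pos_mult_at_top sqrt_inf)
    then have "\<forall>\<^sub>F k in sequentially. b' - b \<le> (S - (p \<circ> r) k) / (2 * (N + S)) * sqrt ((m \<circ> r) k)"
      unfolding filterlim_at_top by blast
    then show ?thesis by (intro that[OF b']) (auto elim!: eventually_mono simp: algebra_simps)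
  qed
  have "\<forall>\<^sub>F k in sequentially. measure (Wn N ((m \<circ> r) k) ((x \<circ> r) k)) {y \<in> space (PiM {..<(m \<circ> r) k} (\<lambda>_. borel)).
            quadratic_sum N (- S / (2 * N * (N + S))) (1 / (N + S)) ((m \<circ> r) k) ((x \<circ> r) k) y \<le> b' * sqrt ((m \<circ> r) k)}
           \<le> ?g - \<eta>"
    using ev
  proof eventually_elim
    case (elim k)
    let ?n = "(m \<circ> r) k" let ?x = "(x \<circ> r) k"
    interpret Wx: prob_space "Wn N ?n ?x" by (rule prob_space_Wn[OF N])
    have s: "?n * S - (\<Sum>j<?n. (?x j)\<^sup>2) = sqrt ?n * sqrt ?n * (S - (p \<circ> r) k)"
      using pow[of "r k"] by (cases "?n = 0") (auto simp: p_def field_simps)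
    have "sqrt ?n * b' \<le> sqrt ?n * (b + sqrt ?n * ((S - (p \<circ> r) k) / (2 * (N + S))))"
      using elim by (intro mult_left_mono) auto
    then have "b' * sqrt ?n \<le> b * sqrt ?n + (?n * S - (\<Sum>j<?n. (?x j)\<^sup>2)) / (2 * (N + S))"
      unfolding s by (simp only: distrib_left times_divide_eq_right mult.assoc mult.commute[of b] mult.commute[of b'])
    then have "measure (Wn N ?n ?x) {y \<in> space (PiM {..<?n} (\<lambda>_. borel)).
            quadratic_sum N (- S / (2 * N * (N + S))) (1 / (N + S)) ?n ?x y \<le> b' * sqrt ?n} \<le> ?P ?n ?x"
      unfolding info_density_le_iff[OF N S] by (intro Wx.finite_measure_mono) auto
    then show ?case using bad[of "r k"] by simp
  qed
  then have "Gcdf (b' / sqrt v) \<le> ?g - \<eta>"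
    using clt[of b'] by (intro tendsto_upperbound[OF _ _ sequentially_bot])
  with b' show False by simp
qed

text \<open>The factor \<open>2 * (N + S)\<close> cancels the denominator of the deficit, which is
  therefore at most \<open>d * sqrt n\<close> and moves the threshold from \<open>b\<close> to
  \<open>b + d\<close>. The same power bound forces normalised powers to converge to
  \<open>S\<close>, so no subsequence has to be extracted.\<close>

lemma info_density_lower_tail_le:
  fixes N S \<eta> b d :: real
  assumes N: "N > 0" and S: "S > 0" and \<eta>: "\<eta> > 0" and d: "d \<ge> 0"
  shows "\<forall>\<^sub>F n in sequentially. \<forall>x. n * S - 2 * (N + S) * d * sqrt n \<le> (\<Sum>j<n. (x j)\<^sup>2) \<and> (\<Sum>j<n. (x j)\<^sup>2) \<le> n * S \<longrightarrow>
     measure (Wn N n x) {y \<in> space (PiM {..<n} (\<lambda>_. borel)). info_density N S n x y \<le> n * CG N S + b * sqrt n}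
       \<le> Gcdf ((b + d) / sqrt (dispersion N S)) + \<eta>"
    (is "\<forall>\<^sub>F n in sequentially. \<forall>x. ?lo n x \<and> ?pow n x \<longrightarrow> ?P n x \<le> ?g + \<eta>")
proof (rule ccontr)
  assume "\<not> ?thesis"
  then have "\<forall>k. \<exists>n x. n \<ge> k \<and> ?lo n x \<and> ?pow n x \<and> ?P n x > ?g + \<eta>"
    by (auto simp: eventually_sequentially not_le)
  from choice[OF this] obtain m where
    "\<forall>k. \<exists>x. m k \<ge> k \<and> ?lo (m k) x \<and> ?pow (m k) x \<and> ?P (m k) x > ?g + \<eta>" by blast
  from choice[OF this] obtain x where m: "\<And>k. m k \<ge> k" and lo: "\<And>k. ?lo (m k) (x k)"
    and pow: "\<And>k. ?pow (m k) (x k)" and bad: "\<And>k. ?P (m k) (x k) > ?g + \<eta>" by blast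
  have minf: "filterlim m at_top sequentially"
    by (rule filterlim_at_top_mono[OF filterlim_ident]) (use m in \<open>auto intro: always_eventually\<close>)
  have sqrt_inf: "filterlim (\<lambda>k. sqrt (m k)) at_top sequentially"
    by (intro filterlim_compose[OF sqrt_at_top] filterlim_compose[OF filterlim_real_sequentially minf])
  have "(\<lambda>k. (\<Sum>j<m k. (x k j)\<^sup>2) / m k) \<longlonglongrightarrow> S"
  proof (rule tendsto_sandwich)
    have "(\<lambda>k. S - (2 * (N + S) * d) / sqrt (m k)) \<longlonglongrightarrow> S - 0"
      by (intro tendsto_diff tendsto_const tendsto_divide_0[OF tendsto_const]
          filterlim_mono[OF sqrt_inf at_top_le_at_infinity order_refl])
    then show "(\<lambda>k. S - (2 * (N + S) * d) / sqrt (m k)) \<longlonglongrightarrow> S" by simp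
    have "1 \<le> m k" if "k \<ge> 1" for k using m[of k] that by linarith
    then have pos: "\<forall>\<^sub>F k in sequentially. 1 \<le> m k"
      unfolding eventually_sequentially by blast
    show "\<forall>\<^sub>F k in sequentially. S - (2 * (N + S) * d) / sqrt (m k) \<le> (\<Sum>j<m k. (x k j)\<^sup>2) / m k"
      using pos
    proof eventually_elim
      case (elim k)
      have "(2 * (N + S) * d) / sqrt (m k) = (2 * (N + S) * d) * sqrt (m k) / m k"
        using elim by (simp add: divide_simps)
      then have "S - (2 * (N + S) * d) / sqrt (m k) = (m k * S - 2 * (N + S) * d * sqrt (m k)) / m k"
        using elim by (simp add: diff_divide_distrib)
      then show ?case using lo[of k] elim by (simp only:) (intro divide_right_mono, auto)
    qed
    show "\<forall>\<^sub>F k in sequentially. (\<Sum>j<m k. (x k j)\<^sup>2) / m k \<le> S"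
      using pos by eventually_elim (use pow in \<open>simp add: pos_divide_le_eq mult.commute\<close>)
  qed simp
  from info_density_quadratic_sum_clt(2)[OF N S minf this] S
  have clt: "(\<lambda>k. measure (Wn N (m k) (x k)) {y \<in> space (PiM {..<m k} (\<lambda>_. borel)).
            quadratic_sum N (- S / (2 * N * (N + S))) (1 / (N + S)) (m k) (x k) y \<le> (b + d) * sqrt (m k)}) \<longlonglongrightarrow> ?g"
    unfolding dispersion_eq[OF N S] by simp
  have "?g + \<eta> \<le> measure (Wn N (m k) (x k)) {y \<in> space (PiM {..<m k} (\<lambda>_. borel)).
            quadratic_sum N (- S / (2 * N * (N + S))) (1 / (N + S)) (m k) (x k) y \<le> (b + d) * sqrt (m k)}" for k
  proof -
    let ?n = "m k" let ?x = "x k"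
    interpret Wx: prob_space "Wn N ?n ?x" by (rule prob_space_Wn[OF N])
    have "(?n * S - (\<Sum>j<?n. (?x j)\<^sup>2)) / (2 * (N + S)) \<le> d * sqrt ?n"
      using lo[of k] N S by (simp add: pos_divide_le_eq algebra_simps)
    then have "?P ?n ?x \<le> measure (Wn N ?n ?x) {y \<in> space (PiM {..<?n} (\<lambda>_. borel)).
            quadratic_sum N (- S / (2 * N * (N + S))) (1 / (N + S)) ?n ?x y \<le> (b + d) * sqrt ?n}"
      unfolding info_density_le_iff[OF N S] by (intro Wx.finite_measure_mono) (auto simp: algebra_simps)
    then show ?thesis using bad[of k] by simp
  qed
  then have "?g + \<eta> \<le> ?g"
    using clt by (intro tendsto_lowerbound[OF _ _ sequentially_bot]) auto
  with \<eta> show False by simp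
qed

section \<open>Converse\<close>

text \<open>Disjoint decoding sets share a reference mass of at most 1, so the penalties,
  \<open>exp t\<close> times the reference mass of each set, average to at most
  \<open>exp t / code_size c\<close>.\<close>

lemma Pe_ge:
  assumes N: "N > 0" and S: "S > 0" and c: "is_code n c" "power_ok S n c"
    and g: "\<And>x. (\<Sum>j<n. (x j)\<^sup>2) \<le> n * S \<Longrightarrow>
       g \<le> measure (Wn N n x) {y \<in> space (PiM {..<n} (\<lambda>_. borel)). info_density N S n x y \<le> t}"
  shows "g - exp t / code_size c \<le> Pe N n c"
proof -
  obtain M \<phi> D where ceq: "c = (M, \<phi>, D)" by (cases c)
  let ?Q = "Wn (N + S) n (\<lambda>_. 0)"
  interpret Q: prob_space ?Q using N S by (intro prob_space_Wn) simp
  have M: "M \<ge> 1" and dis: "disjoint_family_on D {1..M}"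
    and D: "\<And>i. i \<in> {1..M} \<Longrightarrow> D i \<in> sets (PiM {..<n} (\<lambda>_. borel))"
    using c(1) by (auto simp: is_code_def ceq cong: sets_PiM_cong)
  have one: "g - exp t * measure ?Q (D i) \<le> 1 - measure (Wn N n (\<phi> i)) (D i)" if i: "i \<in> {1..M}" for i
  proof -
    have "g \<le> measure (Wn N n (\<phi> i)) {y \<in> space (PiM {..<n} (\<lambda>_. borel)). info_density N S n (\<phi> i) y \<le> t}"
      using c(2) i by (intro g) (auto simp: power_ok_def ceq)
    then show ?thesis
      using Wn_le_info_density[OF N S D[OF i], of "\<phi> i" t]
        measure_info_density_greater[OF N, of n "\<phi> i" t S] by linarith
  qed
  have "(\<Sum>i=1..M. measure ?Q (D i)) = measure ?Q (\<Union>i\<in>{1..M}. D i)"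
    using D dis by (intro Q.finite_measure_finite_Union[symmetric]) auto
  also have "\<dots> \<le> 1" by (rule Q.prob_le_1)
  finally have "M * g - exp t \<le> M * g - exp t * (\<Sum>i=1..M. measure ?Q (D i))" by simp
  also have "\<dots> = (\<Sum>i=1..M. g - exp t * measure ?Q (D i))"
    by (simp add: sum_subtractf sum_distrib_left)
  also have "\<dots> \<le> (\<Sum>i=1..M. 1 - measure (Wn N n (\<phi> i)) (D i))"
    by (intro sum_mono one)
  also have "\<dots> = M * Pe N n c" using M by (simp add: Pe_def ceq)
  finally show ?thesis using M by (simp add: code_size_def ceq field_simps)
qed

text \<open>The code is tested at a threshold \<open>b\<close> slightly below \<open>a\<close>. The
  penalty then decays exponentially in \<open>sqrt n\<close>, and continuity of \<open>Gcdf\<close>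
  recovers the value at \<open>a\<close>.\<close>

theorem Gcdf_le_limsup_Pe:
  assumes N: "N > 0" and S: "S > 0" and \<Phi>: "admissible S \<Phi>" and rate: "second_order_rate N S \<Phi> \<ge> ereal a"
  shows "limsup_Pe N \<Phi> \<ge> ereal (Gcdf (a / sqrt (dispersion N S)))"
proof (rule ccontr)
  assume less: "\<not> ?thesis"
  let ?G = "\<lambda>b. Gcdf (b / sqrt (dispersion N S))"
  have "limsup_Pe N \<Phi> < ereal (?G a)" using less by simp
  from ereal_dense2[OF this] obtain c where c: "limsup_Pe N \<Phi> < ereal c" "c < ?G a"
    unfolding less_ereal.simps(1) by blast
  have "isCont ?G a"
    using dispersion_pos[OF N S] by (intro isCont_o2[OF _ isCont_Gcdf] isCont_divide continuous_ident continuous_const) simp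
  then have "(?G \<longlongrightarrow> ?G a) (at_left a)"
    unfolding isCont_def filterlim_at_split by (rule conjunct1)
  then have "\<forall>\<^sub>F b in at_left a. ?G b > c" using c(2) by (rule order_tendstoD(1))
  moreover have "\<forall>\<^sub>F b in at_left a. b < a" by (simp add: eventually_at_filter)
  ultimately have "\<forall>\<^sub>F b in at_left a. ?G b > c \<and> b < a" by (rule eventually_conj)
  then obtain b where b: "?G b > c" "b < a" using eventually_happens'[OF trivial_limit_at_left_real] by blast
  \<comment> \<open>Half the gap: one share for the error in the lower tail, one for the penalty
    \<open>exp t / code_size (\<Phi> n)\<close>.\<close>
  define \<eta> where "\<eta> = (?G b - c) / 2"
  have \<eta>: "\<eta> > 0" using b by (simp add: \<eta>_def)
  \<comment> \<open>A liminf of at least \<open>a\<close> yields eventual lower bounds only strictly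
    below \<open>a\<close>. The midpoint still beats the threshold by half of
    \<open>a - b\<close>.\<close>
  have "ereal ((a + b) / 2) < second_order_rate N S \<Phi>"
    using b(2) rate by (intro less_le_trans[OF _ rate]) simp
  then have ev1: "\<forall>\<^sub>F n in sequentially. (a + b) / 2 < (1 / sqrt n) * (ln (code_size (\<Phi> n)) - n * CG N S)"
    unfolding second_order_rate_def by (auto dest: less_LiminfD)
  have "filterlim (\<lambda>n. (a - b) / 2 * sqrt (real n)) at_top sequentially"
    using b(2) by (intro filterlim_tendsto_pos_mult_at_top[OF tendsto_const]
      filterlim_compose[OF sqrt_at_top] filterlim_real_sequentially) simp
  then have "filterlim (\<lambda>n. - ((a - b) / 2 * sqrt (real n))) at_bot sequentially"
    by (simp add: filterlim_uminus_at_top)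
  then have "(\<lambda>n. exp (- ((a - b) / 2 * sqrt (real n)))) \<longlonglongrightarrow> 0"
    by (rule filterlim_compose[OF exp_at_bot])
  then have ev2: "\<forall>\<^sub>F n in sequentially. exp (- ((a - b) / 2 * sqrt (real n))) < \<eta>"
    using \<eta> by (rule order_tendstoD(2))
  have "\<forall>\<^sub>F n in sequentially. ereal c \<le> ereal (Pe N n (\<Phi> n))"
    using ev1 ev2 info_density_lower_tail_ge[OF N S \<eta>, of b] eventually_gt_at_top[of 0]
  proof eventually_elim
    case (elim n)
    let ?t = "n * CG N S + b * sqrt n"
    have code: "is_code n (\<Phi> n)" "power_ok S n (\<Phi> n)" using \<Phi> by (auto simp: admissible_def)
    have M: "real (code_size (\<Phi> n)) > 0"
      using code(1) by (auto simp: is_code_def code_size_def split: prod.splits)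
    have "(a + b) / 2 * sqrt n < ln (code_size (\<Phi> n)) - n * CG N S"
      using elim(1,4) by (simp add: field_simps)
    then have "?t - ln (code_size (\<Phi> n)) \<le> - ((a - b) / 2 * sqrt n)"
      by (simp add: field_simps)
    then have "exp (?t - ln (code_size (\<Phi> n))) \<le> exp (- ((a - b) / 2 * sqrt n))" by simp
    then have "exp ?t / code_size (\<Phi> n) < \<eta>"
      using elim(2) M by (simp add: exp_diff)
    moreover have "?G b - \<eta> - exp ?t / code_size (\<Phi> n) \<le> Pe N n (\<Phi> n)"
      using elim(3) by (intro Pe_ge[OF N S code]) auto
    moreover have "2 * \<eta> = ?G b - c" by (simp add: \<eta>_def)
    ultimately have "c \<le> Pe N n (\<Phi> n)" by linarith
    then show ?case by simp
  qed
  then have "ereal c \<le> limsup_Pe N \<Phi>"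
    unfolding limsup_Pe_def by (intro le_Limsup) auto
  with c(1) show False by simp
qed

section \<open>Achievability\<close>

text \<open>Feinstein's argument: as long as the decoding sets chosen so far have small probability under
  the reference measure \<open>Q\<close>, some codeword in \<open>F\<close> has most of its likely outputs outside their union.\<close>

lemma feinstein_greedy:
  fixes P :: "'x measure" and K :: "'x \<Rightarrow> 'y measure" and Q :: "'y measure"
  assumes P: "prob_space P" and Q: "prob_space Q"
    and K: "\<And>x. prob_space (K x)" "\<And>x. sets (K x) = sets Q"
    and F: "F \<in> sets P"
    and avg: "\<And>D. D \<in> sets Q \<Longrightarrow> (\<integral>\<^sup>+x. emeasure (K x) D * indicator F x \<partial>P) \<le> emeasure Q D"
    and B: "\<And>x. B x \<in> sets Q" "\<And>x. measure Q (B x) \<le> q"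
    and L: "\<And>x. x \<in> F \<Longrightarrow> L \<le> measure (K x) (B x)"
    and \<eta>: "\<eta> \<ge> 0" and M: "\<And>k. k < M \<Longrightarrow> real k * q < \<eta> * measure P F"
  shows "\<exists>\<phi> D. (\<forall>i\<in>{1..M}. \<phi> i \<in> F \<and> D i \<in> sets Q \<and> D i \<subseteq> B (\<phi> i) \<and> L - \<eta> \<le> measure (K (\<phi> i)) (D i))
           \<and> disjoint_family_on D {1..M}"
  using M
proof (induction M)
  case 0
  then show ?case by (simp add: disjoint_family_on_def)
next
  case (Suc M)
  interpret P: prob_space P by fact
  interpret Q: prob_space Q by fact
  interpret K: prob_space "K x" for x by fact
  note K(2)[measurable_cong]
  from Suc obtain \<phi> D where IH: "\<And>i. i \<in> {1..M} \<Longrightarrow> \<phi> i \<in> F" "\<And>i. i \<in> {1..M} \<Longrightarrow> D i \<in> sets Q"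
      "\<And>i. i \<in> {1..M} \<Longrightarrow> D i \<subseteq> B (\<phi> i)" "\<And>i. i \<in> {1..M} \<Longrightarrow> L - \<eta> \<le> measure (K (\<phi> i)) (D i)"
      and dis: "disjoint_family_on D {1..M}"
    by (metis less_SucI)
  define U where "U = (\<Union>i\<in>{1..M}. D i)"
  have U[measurable]: "U \<in> sets Q" unfolding U_def using IH(2) by auto
  have "measure Q U \<le> (\<Sum>i\<in>{1..M}. measure Q (D i))"
    unfolding U_def using IH(2) by (intro measure_UNION_le) auto
  also have "\<dots> \<le> (\<Sum>i\<in>{1..M}. q)"
  proof (intro sum_mono)
    fix i assume i: "i \<in> {1..M}"
    have "measure Q (D i) \<le> measure Q (B (\<phi> i))" using IH(3)[OF i] B(1) by (intro Q.finite_measure_mono)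
    then show "measure Q (D i) \<le> q" using B(2)[of "\<phi> i"] by linarith
  qed
  \<comment> \<open>Only the \<open>M\<close> sets already chosen count when codeword
    \<open>Suc M\<close> is selected, so the size hypothesis is used at
    \<open>k = M\<close>.\<close>
  also have "\<dots> < \<eta> * measure P F" using Suc.prems[of M] by simp
  finally have QU: "measure Q U < \<eta> * measure P F" .
  \<comment> \<open>Otherwise the occupied region \<open>U\<close> has probability at least
    \<open>\<eta>\<close> under every input in \<open>F\<close>, and averaging gives
    \<open>U\<close> too much mass under \<open>Q\<close>. Restricting the average by an indicator,
    instead of conditioning on \<open>F\<close>, places the factor \<open>measure P F\<close> in the
    size bound.\<close>
  have "\<exists>x\<in>F. L - \<eta> \<le> measure (K x) (B x - U)"
  proof (rule ccontr)
    assume "\<not> ?thesis"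
    then have small: "\<And>x. x \<in> F \<Longrightarrow> measure (K x) (B x - U) < L - \<eta>" by auto
    have "ennreal \<eta> * indicator F x \<le> emeasure (K x) U * indicator F x" for x
    proof (cases "x \<in> F")
      case True
      have BK: "B x \<in> sets (K x)" "U \<in> sets (K x)" using B(1) U K(2) by auto
      have "measure (K x) (B x) \<le> measure (K x) ((B x - U) \<union> U)"
        using BK by (intro K.finite_measure_mono) auto
      also have "\<dots> \<le> measure (K x) (B x - U) + measure (K x) U"
        using BK by (intro measure_Un_le) auto
      finally have "\<eta> \<le> measure (K x) U" using small[OF True] L[OF True] by linarith
      then show ?thesis using True by (simp add: K.emeasure_eq_measure ennreal_leI)
    qed simp
    then have "(\<integral>\<^sup>+x. ennreal \<eta> * indicator F x \<partial>P) \<le> (\<integral>\<^sup>+x. emeasure (K x) U * indicator F x \<partial>P)"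
      by (intro nn_integral_mono)
    also have "\<dots> \<le> emeasure Q U" by (rule avg[OF U])
    finally have "ennreal \<eta> * emeasure P F \<le> emeasure Q U"
      using F by (simp add: nn_integral_cmult_indicator)
    then have "\<eta> * measure P F \<le> measure Q U"
      using \<eta> by (simp add: P.emeasure_eq_measure Q.emeasure_eq_measure flip: ennreal_mult')
    with QU show False by simp
  qed
  then obtain x where x: "x \<in> F" "L - \<eta> \<le> measure (K x) (B x - U)" by blast
  define \<phi>' where "\<phi>' = \<phi>(Suc M := x)"
  define D' where "D' = D(Suc M := B x - U)"
  have "\<phi>' i \<in> F \<and> D' i \<in> sets Q \<and> D' i \<subseteq> B (\<phi>' i) \<and> L - \<eta> \<le> measure (K (\<phi>' i)) (D' i)"
    if "i \<in> {1..Suc M}" for i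
  proof (cases "i = Suc M")
    case True
    then show ?thesis using x B(1)[of x] U by (auto simp: \<phi>'_def D'_def)
  next
    case False
    then have "i \<in> {1..M}" using that by auto
    then show ?thesis using IH False by (auto simp: \<phi>'_def D'_def)
  qed
  moreover have "disjoint_family_on D' {1..Suc M}"
  proof -
    have "D' i \<inter> D' j = {}" if "i \<in> {1..M}" "j \<in> {1..Suc M}" "i \<noteq> j" for i j
    proof (cases "j = Suc M")
      case True
      then show ?thesis using that(1) by (auto simp: D'_def U_def)
    next
      case False
      then show ?thesis using that dis by (auto simp: D'_def disjoint_family_on_def)
    qed
    moreover have "i \<in> {1..M} \<or> i = Suc M" if "i \<in> {1..Suc M}" for i using that by auto
    ultimately show ?thesis unfolding disjoint_family_on_def by (metis Int_commute)
  qed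
  ultimately show ?case by blast
qed

text \<open>The upper bound is the power constraint; the lower one limits the loss of mean
  information to a multiple of \<open>w\<close>.\<close>

definition power_shell :: "real \<Rightarrow> nat \<Rightarrow> real \<Rightarrow> (nat \<Rightarrow> real) set" where
  "power_shell S n w = {x \<in> space (PiM {..<n} (\<lambda>_. borel)). n * S - w \<le> (\<Sum>j<n. (x j)\<^sup>2) \<and> (\<Sum>j<n. (x j)\<^sup>2) \<le> n * S}"

lemma power_shell_sets[measurable]: "power_shell S n w \<in> sets (PiM {..<n} (\<lambda>_. borel))"
  unfolding power_shell_def by measurable

text \<open>Under the Gaussian input law the power minus \<open>n * S\<close> is itself a
  \<open>quadratic_sum\<close>, with zero input and noise variance \<open>S\<close>. Its
  fluctuations have order \<open>sqrt n\<close>, so the shell keeps a positive limiting probability;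
  \<open>c\<close> is half of a lower bound for it.\<close>

lemma power_shell_measure_ge:
  fixes S w :: real
  assumes S: "S > 0" and w: "w > 0"
  obtains c where "c > 0" "\<forall>\<^sub>F n in sequentially. measure (Wn S n (\<lambda>_. 0)) (power_shell S n (w * sqrt n)) \<ge> c"
proof
  \<comment> \<open>Left unsimplified to match the variance in \<open>quadratic_sum_clt\<close> for
    \<open>\<alpha> = 1\<close>, \<open>\<beta> = 0\<close>, \<open>p = 0\<close>; its value is
    \<open>2 * S\<^sup>2\<close>.\<close>
  define v where "v = 2 * (1 * S)\<^sup>2 + 0\<^sup>2 * S * 0"
  have v: "v > 0" using S by (simp add: v_def)
  define c where "c = (Gcdf (0 / sqrt v) - Gcdf (- w / sqrt v)) / 2"
  show c: "c > 0"
    using w v by (simp add: c_def strict_mono_less[OF Gcdf_strict_mono])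
  define A where "A n b = {y \<in> space (PiM {..<n} (\<lambda>_. borel)). quadratic_sum S 1 0 n (\<lambda>_. 0) y \<le> b * sqrt n}" for n b
  have clt: "(\<lambda>n. measure (Wn S n (\<lambda>_. 0)) (A n b)) \<longlonglongrightarrow> Gcdf (b / sqrt v)" for b
    unfolding A_def
    by (rule quadratic_sum_clt[where m="\<lambda>n. n" and x="\<lambda>_ _. 0" and p=0, OF S filterlim_ident _ v_def v]) simp
  have "(\<lambda>n. measure (Wn S n (\<lambda>_. 0)) (A n 0) - measure (Wn S n (\<lambda>_. 0)) (A n (- w))) \<longlonglongrightarrow> 2 * c"
    using tendsto_diff[OF clt[of 0] clt[of "-w"]] by (simp only: c_def field_sum_of_halves mult_2)
  then have "\<forall>\<^sub>F n in sequentially. measure (Wn S n (\<lambda>_. 0)) (A n 0) - measure (Wn S n (\<lambda>_. 0)) (A n (- w)) > c"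
    using c by (intro order_tendstoD(1)) auto
  then show "\<forall>\<^sub>F n in sequentially. measure (Wn S n (\<lambda>_. 0)) (power_shell S n (w * sqrt n)) \<ge> c"
  proof eventually_elim
    case (elim n)
    interpret P: prob_space "Wn S n (\<lambda>_. 0)" by (rule prob_space_Wn[OF S])
    have qs: "quadratic_sum S 1 0 n (\<lambda>_. 0) y = (\<Sum>j<n. (y j)\<^sup>2) - n * S" for y
      by (simp add: quadratic_sum_def sum_subtractf)
    have [measurable]: "A n b \<in> sets (PiM {..<n} (\<lambda>_. borel))" for b unfolding A_def by measurable
    have "A n 0 \<subseteq> power_shell S n (w * sqrt n) \<union> A n (- w)"
      by (auto simp: A_def power_shell_def qs)
    then have "measure (Wn S n (\<lambda>_. 0)) (A n 0) \<le> measure (Wn S n (\<lambda>_. 0)) (power_shell S n (w * sqrt n) \<union> A n (- w))"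
      by (intro P.finite_measure_mono) auto
    also have "\<dots> \<le> measure (Wn S n (\<lambda>_. 0)) (power_shell S n (w * sqrt n)) + measure (Wn S n (\<lambda>_. 0)) (A n (- w))"
      by (intro measure_Un_le) auto
    finally show ?case using elim by linarith
  qed
qed

text \<open>Greedy selection with the Gaussian input law: dropping the shell indicator and applying
  \<open>Wn_convolution\<close> gives the averaging hypothesis. The size bound has
  \<open>real M - 1\<close> because the last codeword competes with only \<open>M - 1\<close>
  earlier sets.\<close>

lemma exists_power_code:
  fixes N S L \<eta> t w :: real
  assumes N: "N > 0" and S: "S > 0" and M: "M \<ge> 1" and \<eta>: "\<eta> \<ge> 0"
    and L: "\<And>x. x \<in> power_shell S n w \<Longrightarrow>
       L \<le> measure (Wn N n x) {y \<in> space (PiM {..<n} (\<lambda>_. borel)). info_density N S n x y > t}"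
    and size: "(real M - 1) * exp (- t) < \<eta> * measure (Wn S n (\<lambda>_. 0)) (power_shell S n w)"
  shows "\<exists>c. is_code n c \<and> power_ok S n c \<and> code_size c = M \<and> Pe N n c \<le> 1 - L + \<eta>"
proof -
  have NS: "N + S > 0" using N S by simp
  have "\<exists>\<phi> D. (\<forall>i\<in>{1..M}. \<phi> i \<in> power_shell S n w \<and> D i \<in> sets (Wn (N + S) n (\<lambda>_. 0)) \<and>
        D i \<subseteq> {y \<in> space (PiM {..<n} (\<lambda>_. borel)). info_density N S n (\<phi> i) y > t} \<and>
        L - \<eta> \<le> measure (Wn N n (\<phi> i)) (D i)) \<and> disjoint_family_on D {1..M}"
  proof (rule feinstein_greedy[where P="Wn S n (\<lambda>_. 0)" and q="exp (- t)"])
    show "prob_space (Wn S n (\<lambda>_. 0))" "prob_space (Wn (N + S) n (\<lambda>_. 0))" "prob_space (Wn N n x)" for x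
      using N S NS by (auto intro: prob_space_Wn)
    show "(\<integral>\<^sup>+x. emeasure (Wn N n x) D * indicator (power_shell S n w) x \<partial>Wn S n (\<lambda>_. 0)) \<le> emeasure (Wn (N + S) n (\<lambda>_. 0)) D"
      if "D \<in> sets (Wn (N + S) n (\<lambda>_. 0))" for D
    proof -
      have "(\<integral>\<^sup>+x. emeasure (Wn N n x) D * indicator (power_shell S n w) x \<partial>Wn S n (\<lambda>_. 0))
        \<le> (\<integral>\<^sup>+x. emeasure (Wn N n x) D \<partial>Wn S n (\<lambda>_. 0))"
        by (intro nn_integral_mono) (auto simp: indicator_def)
      also have "\<dots> = emeasure (Wn (N + S) n (\<lambda>_. 0)) D"
        using that by (intro Wn_convolution N S) simp
      finally show ?thesis .
    qed
    show "real k * exp (- t) < \<eta> * measure (Wn S n (\<lambda>_. 0)) (power_shell S n w)" if "k < M" for k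
    proof -
      have "real k * exp (- t) \<le> (real M - 1) * exp (- t)" using that by (intro mult_right_mono) auto
      then show ?thesis using size by linarith
    qed
  qed (use \<eta> L Wn_info_density_greater[OF N S] in auto)
  then obtain \<phi> D where *: "\<And>i. i \<in> {1..M} \<Longrightarrow> \<phi> i \<in> power_shell S n w"
      "\<And>i. i \<in> {1..M} \<Longrightarrow> D i \<in> sets (PiM {..<n} (\<lambda>_. borel))"
      "\<And>i. i \<in> {1..M} \<Longrightarrow> L - \<eta> \<le> measure (Wn N n (\<phi> i)) (D i)" "disjoint_family_on D {1..M}"
    unfolding Wn_sets by blast
  have "sets (PiM {..<n} (\<lambda>_. lborel :: real measure)) = sets (PiM {..<n} (\<lambda>_. borel))"
    by (intro sets_PiM_cong) auto
  then have "is_code n (M, \<phi>, D)" using * M by (auto simp: is_code_def)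
  moreover have "power_ok S n (M, \<phi>, D)" using *(1) by (auto simp: power_ok_def power_shell_def)
  moreover have "Pe N n (M, \<phi>, D) \<le> 1 - L + \<eta>"
  proof -
    have "(\<Sum>i=1..M. 1 - measure (Wn N n (\<phi> i)) (D i)) \<le> (\<Sum>i=1..M. 1 - L + \<eta>)"
      using *(3) by (intro sum_mono) (smt (verit))
    then show ?thesis using M by (simp add: Pe_def field_simps)
  qed
  ultimately show ?thesis by (intro exI[of _ "(M, \<phi>, D)"]) (simp add: code_size_def)
qed

text \<open>The tolerance is split in three: continuity of \<open>Gcdf\<close>, error in the tail
  limit, loss in the greedy selection. One \<open>d\<close> in the argument \<open>a + 2 * d\<close>
  lets the threshold \<open>b = a + d\<close> absorb a constant factor in the code size; the other
  pays for the shell.\<close>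

theorem exists_codes_Gcdf:
  fixes N S a \<eta> :: real
  assumes N: "N > 0" and S: "S > 0" and \<eta>: "\<eta> > 0"
  shows "\<exists>\<Phi>. admissible S \<Phi> \<and> second_order_rate N S \<Phi> \<ge> ereal a \<and>
           limsup_Pe N \<Phi> \<le> ereal (Gcdf (a / sqrt (dispersion N S)) + \<eta>)"
proof -
  let ?G = "\<lambda>b. Gcdf (b / sqrt (dispersion N S))"
  have \<eta>3: "\<eta> / 3 > 0" using \<eta> by simp
  have "isCont (\<lambda>d. ?G (a + 2 * d)) 0"
    using dispersion_pos[OF N S]
    by (intro isCont_o2[OF _ isCont_Gcdf] isCont_divide continuous_intros) simp
  then have "((\<lambda>d. ?G (a + 2 * d)) \<longlongrightarrow> ?G (a + 2 * 0)) (at_right 0)"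
    unfolding isCont_def filterlim_at_split by (rule conjunct2)
  then have "\<forall>\<^sub>F d in at_right 0. ?G (a + 2 * d) < ?G a + \<eta> / 3"
    using \<eta> by (intro order_tendstoD(2)) auto
  moreover have "\<forall>\<^sub>F d in at_right (0::real). d > 0" by (simp add: eventually_at_filter)
  ultimately have "\<forall>\<^sub>F d in at_right 0. ?G (a + 2 * d) < ?G a + \<eta> / 3 \<and> d > 0" by (rule eventually_conj)
  then obtain d where d: "?G (a + 2 * d) < ?G a + \<eta> / 3" "d > 0"
    using eventually_happens'[OF trivial_limit_at_right_real] by blast
  define b where "b = a + d"
  have bd: "b + d = a + 2 * d" by (simp add: b_def)
  define t where "t n = n * CG N S + b * sqrt n" for n :: nat
  define w where "w = 2 * (N + S) * d"
  have w: "w > 0" using N S d by (simp add: w_def)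
  obtain c where c: "c > 0"
    and shell: "\<forall>\<^sub>F n in sequentially. measure (Wn S n (\<lambda>_. 0)) (power_shell S n (w * sqrt n)) \<ge> c"
    using power_shell_measure_ge[OF S w] by blast
  \<comment> \<open>For \<open>M\<close> the ceiling of \<open>\<kappa> * exp (t n)\<close>, the
    product \<open>(real M - 1) * exp (- t n)\<close> is below \<open>\<kappa>\<close>, hence below
    \<open>\<eta> / 3\<close> times the shell probability. This constant factor disappears at scale
    \<open>sqrt n\<close>.\<close>
  define \<kappa> where "\<kappa> = \<eta> / 3 * c"
  have \<kappa>: "\<kappa> > 0" using \<eta> c by (simp add: \<kappa>_def)
  define good where "good n co \<longleftrightarrow> is_code n co \<and> power_ok S n co \<and> real (code_size co) \<ge> \<kappa> * exp (t n) \<and>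
     Pe N n co \<le> ?G a + \<eta>" for n co
  have ex: "\<forall>\<^sub>F n in sequentially. \<exists>co. good n co"
    using shell info_density_lower_tail_le[OF N S \<eta>3 less_imp_le[OF d(2)], of b]
  proof eventually_elim
    case (elim n)
    let ?F = "power_shell S n (w * sqrt n)"
    define M where "M = nat \<lceil>\<kappa> * exp (t n)\<rceil>"
    have pos: "\<kappa> * exp (t n) > 0" using \<kappa> by simp
    then have M1: "M \<ge> 1" unfolding M_def by linarith
    have Mge: "real M \<ge> \<kappa> * exp (t n)" unfolding M_def by (rule real_nat_ceiling_ge)
    have "real M - 1 < \<kappa> * exp (t n)" unfolding M_def using pos by linarith
    then have "(real M - 1) * exp (- t n) < \<kappa> * exp (t n) * exp (- t n)" by (intro mult_strict_right_mono) auto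
    also have "\<dots> = \<eta> / 3 * c" by (simp add: \<kappa>_def exp_minus)
    also have "\<dots> \<le> \<eta> / 3 * measure (Wn S n (\<lambda>_. 0)) ?F" using elim(1) \<eta> by (intro mult_left_mono) auto
    finally have size: "(real M - 1) * exp (- t n) < \<eta> / 3 * measure (Wn S n (\<lambda>_. 0)) ?F" .
    have "1 - (?G (b + d) + \<eta> / 3) \<le>
        measure (Wn N n x) {y \<in> space (PiM {..<n} (\<lambda>_. borel)). info_density N S n x y > t n}"
      if x: "x \<in> ?F" for x
    proof -
      have "measure (Wn N n x) {y \<in> space (PiM {..<n} (\<lambda>_. borel)). info_density N S n x y \<le> t n}
          \<le> ?G (b + d) + \<eta> / 3"
        using elim(2) x unfolding t_def by (simp add: power_shell_def w_def)
      then show ?thesis using measure_info_density_greater[OF N, of n x "t n" S] by linarith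
    qed
    from exists_power_code[OF N S M1 less_imp_le[OF \<eta>3] this size]
    obtain co where co: "is_code n co" "power_ok S n co" "code_size co = M"
        "Pe N n co \<le> 1 - (1 - (?G (b + d) + \<eta> / 3)) + \<eta> / 3"
      by blast
    have "Pe N n co \<le> ?G a + \<eta>" using co(4) d(1) unfolding bd by linarith
    then show ?case using co Mge unfolding good_def by (intro exI[of _ co]) simp
  qed
  \<comment> \<open>A default for the finitely many block lengths without a good code: one message,
    the zero codeword and an empty decoding set. The limits ignore these terms.\<close>
  define triv :: code where "triv = (1, (\<lambda>_ _. 0), (\<lambda>_. {}))"
  have triv: "is_code n triv \<and> power_ok S n triv" for n
    using S by (auto simp: triv_def is_code_def power_ok_def disjoint_family_on_def)
  define \<Phi> where "\<Phi> n = (if \<exists>co. good n co then SOME co. good n co else triv)" for n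
  have good: "\<forall>\<^sub>F n in sequentially. good n (\<Phi> n)"
    using ex by eventually_elim (auto simp: \<Phi>_def intro: someI_ex)
  have "admissible S \<Phi>"
    unfolding admissible_def
  proof
    fix n
    show "is_code n (\<Phi> n) \<and> power_ok S n (\<Phi> n)"
    proof (cases "\<exists>co. good n co")
      case True
      then have "good n (\<Phi> n)" by (auto simp: \<Phi>_def intro: someI_ex)
      then show ?thesis by (simp add: good_def)
    qed (simp add: \<Phi>_def triv)
  qed
  moreover have "second_order_rate N S \<Phi> \<ge> ereal a"
  proof -
    have "filterlim (\<lambda>n. d * sqrt (real n)) at_top sequentially"
      using d(2) by (intro filterlim_tendsto_pos_mult_at_top[OF tendsto_const]
        filterlim_compose[OF sqrt_at_top] filterlim_real_sequentially)
    then have "\<forall>\<^sub>F n in sequentially. - ln \<kappa> \<le> d * sqrt (real n)"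
      unfolding filterlim_at_top by blast
    then have "\<forall>\<^sub>F n in sequentially. ereal a \<le> ereal ((1 / sqrt n) * (ln (code_size (\<Phi> n)) - n * CG N S))"
      using good eventually_gt_at_top[of 0]
    proof eventually_elim
      case (elim n)
      have le: "\<kappa> * exp (t n) \<le> code_size (\<Phi> n)" using elim(2) by (simp add: good_def)
      have pos: "0 < \<kappa> * exp (t n)" using \<kappa> by simp
      have "ln (\<kappa> * exp (t n)) \<le> ln (code_size (\<Phi> n))"
        by (rule ln_le_cancel_iff[THEN iffD2, OF pos less_le_trans[OF pos le] le])
      then have "ln \<kappa> + t n \<le> ln (code_size (\<Phi> n))" using \<kappa> by (simp add: ln_mult)
      then have "a * sqrt n \<le> ln (code_size (\<Phi> n)) - n * CG N S"
        using elim(1) by (simp add: t_def b_def algebra_simps)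
      then show ?case using elim(3) by (simp add: field_simps)
    qed
    then show ?thesis unfolding second_order_rate_def by (rule Liminf_bounded)
  qed
  moreover have "limsup_Pe N \<Phi> \<le> ereal (?G a + \<eta>)"
    unfolding limsup_Pe_def
    by (rule Limsup_bounded) (use good in \<open>auto elim!: eventually_mono simp: good_def\<close>)
  ultimately show ?thesis by blast
qed

section \<open>Both formulas from the converse and the achievability bound\<close>

theorem mainTheorem4:
  fixes N S a \<epsilon> :: real
  assumes "N > 0" and "S > 0" and "0 < \<epsilon>" and "\<epsilon> < 1"
  shows "CpG a N S = ereal (Gcdf (a / sqrt (dispersion N S))) \<and>
         CeG \<epsilon> N S = ereal (sqrt (dispersion N S) * Ginv \<epsilon>)"
proof
  let ?s = "sqrt (dispersion N S)"
  note NS = assms(1,2)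
  have s: "?s > 0" using dispersion_pos[OF NS] by simp
  show "CpG a N S = ereal (Gcdf (a / ?s))"
  proof (rule antisym)
    show "CpG a N S \<le> ereal (Gcdf (a / ?s))"
    proof (rule ereal_le_epsilon2)
      fix e :: real assume "0 < e"
      from exists_codes_Gcdf[OF NS this, of a] obtain \<Phi> where "admissible S \<Phi>"
        "second_order_rate N S \<Phi> \<ge> ereal a" "limsup_Pe N \<Phi> \<le> ereal (Gcdf (a / ?s) + e)" by blast
      then have "CpG a N S \<le> ereal (Gcdf (a / ?s) + e)"
        unfolding CpG_def by (intro Inf_lower2[of "limsup_Pe N \<Phi>"]) auto
      then show "CpG a N S \<le> ereal (Gcdf (a / ?s)) + ereal e" by simp
    qed
    show "ereal (Gcdf (a / ?s)) \<le> CpG a N S"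
      unfolding CpG_def by (intro Inf_greatest) (auto intro: Gcdf_le_limsup_Pe[OF NS])
  qed
  \<comment> \<open>The same two bounds read in the other direction: as \<open>Gcdf\<close> is
    strictly increasing, a rate beyond \<open>?s * Ginv \<epsilon>\<close> forces the error above
    \<open>\<epsilon>\<close>, and a smaller rate leaves a positive margin.\<close>
  show "CeG \<epsilon> N S = ereal (?s * Ginv \<epsilon>)"
  proof (rule antisym)
    show "CeG \<epsilon> N S \<le> ereal (?s * Ginv \<epsilon>)"
      unfolding CeG_def
    proof (rule Sup_least, clarify)
      fix \<Phi> assume \<Phi>: "admissible S \<Phi>" "limsup_Pe N \<Phi> \<le> ereal \<epsilon>"
      show "second_order_rate N S \<Phi> \<le> ereal (?s * Ginv \<epsilon>)"
      proof (rule ccontr)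
        assume "\<not> second_order_rate N S \<Phi> \<le> ereal (?s * Ginv \<epsilon>)"
        then have "ereal (?s * Ginv \<epsilon>) < second_order_rate N S \<Phi>" by simp
        \<comment> \<open>The rate is an extended real and might be infinite, while the converse
          takes a real one.\<close>
        from ereal_dense2[OF this] obtain r where r: "?s * Ginv \<epsilon> < r" "ereal r < second_order_rate N S \<Phi>"
          unfolding less_ereal.simps(1) by blast
        have "Gcdf (Ginv \<epsilon>) < Gcdf (r / ?s)"
          using r(1) s by (intro strict_monoD[OF Gcdf_strict_mono]) (simp add: pos_less_divide_eq mult.commute)
        then have "ereal \<epsilon> < ereal (Gcdf (r / ?s))" using Gcdf_Ginv[OF assms(3,4)] by simp
        also have "\<dots> \<le> limsup_Pe N \<Phi>" by (rule Gcdf_le_limsup_Pe[OF NS \<Phi>(1) less_imp_le[OF r(2)]])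
        finally show False using \<Phi>(2) by simp
      qed
    qed
    show "ereal (?s * Ginv \<epsilon>) \<le> CeG \<epsilon> N S"
    proof (rule ereal_le_epsilon2)
      fix e :: real assume e: "0 < e"
      let ?r = "?s * Ginv \<epsilon> - e"
      have "Gcdf (?r / ?s) < Gcdf (Ginv \<epsilon>)"
        using e s by (intro strict_monoD[OF Gcdf_strict_mono]) (simp add: pos_divide_less_eq mult.commute)
      \<comment> \<open>This gap is the tolerance handed to the construction, so the resulting error
        bound is \<open>\<epsilon>\<close> itself.\<close>
      then have "\<epsilon> - Gcdf (?r / ?s) > 0" using Gcdf_Ginv[OF assms(3,4)] by simp
      from exists_codes_Gcdf[OF NS this, of ?r] obtain \<Phi> where "admissible S \<Phi>"
        "second_order_rate N S \<Phi> \<ge> ereal ?r" "limsup_Pe N \<Phi> \<le> ereal \<epsilon>" by auto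
      then have "ereal ?r \<le> CeG \<epsilon> N S"
        unfolding CeG_def by (intro Sup_upper2[of "second_order_rate N S \<Phi>"]) auto
      then have "ereal ?r + ereal e \<le> CeG \<epsilon> N S + ereal e" by (rule add_right_mono)
      then show "ereal (?s * Ginv \<epsilon>) \<le> CeG \<epsilon> N S + ereal e" by simp
    qed
  qed
qed

end
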